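(* Let $r\in\{3,4,\dots\}$, let $\varepsilon>0$, and let $n:\mathbb{N}\to\mathbb{N}$ be a function with $1\le n(d)\le 2^d$ for all $d$ and $n(d)\ge r$ for all sufficiently large $d$. For each $d$ (with $n(d)\ge r$) choose the points $S_1,\dots,S_r,X_1,\dots,X_{n(d)-r}\in\{0,1\}^d$ independently and uniformly at random, and set $S:=\{S_1,\dots,S_r\}$, $X:=\{X_1,\dots,X_{n(d)-r}\}$ and $P_2:=\operatorname{conv}(X\cup S)\subset\mathbb{R}^d$. Let $\tilde\tau_r := 1-(1-2^{1-r})H_r$. Then, as $d\to\infty$: 1. If $n(d)\le 2^{(\tilde\tau_r-\varepsilon)d}$ holds for all $d$, then $$\mathbb{P}[\operatorname{conv} S\text{ is a face of }P_2] = 1-o(1).$$ 2. If $n(d)\ge 2^{(\tilde\tau_r+\varepsilon)d}$ holds for all $d$, then $$\mathbb{P}[P_2\cap\operatorname{aff} S\text{ is a face of }P_2] = o(1).$$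
   Context: $\log$ denotes the binary logarithm. For $0<\xi<1$, $h(\xi):=\xi\log\frac1\xi+(1-\xi)\log\frac1{1-\xi}$ is the binary entropy function, and for $r\ge 2$, $$H_r := \frac{1}{2^r-2}\sum_{i=1}^{r-1}\binom{r}{i}h\!\left(\tfrac{i}{r}\right).$$ $\operatorname{conv}$ and $\operatorname{aff}$ denote convex hull and affine hull. A polytope is considered a face of itself. The $o(1)$ terms refer to $d\to\infty$ with $r$, $\varepsilon$ and the function $n$ fixed. *)

theory Defs
  imports
    "HOL-Analysis.Analysis"
    "HOL-Analysis.Finite_Function_Topology"
    "HOL-Probability.Product_PMF"
begin

definition binary_entropy :: "real \<Rightarrow> real" where
  "binary_entropy \<xi> = \<xi> * log 2 (1 / \<xi>) + (1 - \<xi>) * log 2 (1 / (1 - \<xi>))"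

definition mean_entropy :: "nat \<Rightarrow> real" where
  "mean_entropy r = 1 / (2 ^ r - 2) * (\<Sum>i = 1..r - 1. real (r choose i) * binary_entropy (real i / real r))"

definition tau_tilde :: "nat \<Rightarrow> real" where
  "tau_tilde r = 1 - (1 - 2 powr (1 - real r)) * mean_entropy r"

text \<open>
  Since the dimension \<open>d\<close> is a variable that tends to infinity, it cannot be part of the type.
  \<open>\<real>\<^sup>d\<close> is therefore represented by the subspace of those finitely supported functions
  \<^typ>\<open>nat \<Rightarrow>\<^sub>0 real\<close> whose support is contained in \<^term>\<open>{..<d}\<close>. Convex hull, affine hull and
  faces of subsets of this subspace do not depend on the ambient vector space.
\<close>

definition cube_vertices :: "nat \<Rightarrow> (nat \<Rightarrow>\<^sub>0 real) set" where
  "cube_vertices d =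
     {x. Poly_Mapping.keys x \<subseteq> {..<d} \<and> (\<forall>i<d. Poly_Mapping.lookup x i \<in> {0, 1})}"

text \<open>
  \<^const>\<open>pmf_of_set\<close> is only meaningful for finite nonempty sets.
\<close>

lemma cube_vertices_bij_betw:
  "bij_betw Poly_Mapping.keys (cube_vertices d) (Pow {..<d})"
proof (rule bij_betw_byWitness[where f' = "\<lambda>A. Poly_Mapping.Abs_poly_mapping (\<lambda>i. if i \<in> A \<inter> {..<d} then 1 else 0)"])
  have lookup: "Poly_Mapping.lookup (Poly_Mapping.Abs_poly_mapping (\<lambda>i. if i \<in> A \<inter> {..<d} then 1 else (0::real)))
      = (\<lambda>i. if i \<in> A \<inter> {..<d} then 1 else 0)" for A
    by (rule Abs_poly_mapping_inverse) (auto intro: finite_subset[of _ "{..<d}"])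
  show "\<forall>x\<in>cube_vertices d. Poly_Mapping.Abs_poly_mapping
      (\<lambda>i. if i \<in> Poly_Mapping.keys x \<inter> {..<d} then 1 else 0) = x"
    by (rule ballI, rule poly_mapping_eqI)
      (auto simp: lookup cube_vertices_def in_keys_iff subset_iff)
  show "\<forall>A\<in>Pow {..<d}. Poly_Mapping.keys (Poly_Mapping.Abs_poly_mapping
      (\<lambda>i. if i \<in> A \<inter> {..<d} then 1 else (0::real))) = A"
    by (auto simp: in_keys_iff lookup split: if_splits)
  show "Poly_Mapping.keys ` cube_vertices d \<subseteq> Pow {..<d}"
    by (auto simp: cube_vertices_def)
  show "(\<lambda>A. Poly_Mapping.Abs_poly_mapping (\<lambda>i. if i \<in> A \<inter> {..<d} then 1 else 0)) ` Pow {..<d}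
      \<subseteq> cube_vertices d"
    by (auto simp: cube_vertices_def in_keys_iff lookup split: if_splits)
qed

lemma finite_cube_vertices: "finite (cube_vertices d)"
  using bij_betw_finite[OF cube_vertices_bij_betw] by simp

lemma card_cube_vertices: "card (cube_vertices d) = 2 ^ d"
  using bij_betw_same_card[OF cube_vertices_bij_betw] by (simp add: card_Pow)

lemma cube_vertices_nonempty: "cube_vertices d \<noteq> {}"
  using card_cube_vertices[of d] by force

definition random_vertices :: "nat \<Rightarrow> nat \<Rightarrow> (nat \<Rightarrow> nat \<Rightarrow>\<^sub>0 real) pmf" where
  "random_vertices d k = Pi_pmf {1..k} 0 (\<lambda>_. pmf_of_set (cube_vertices d))"

text \<open>
  The joint distribution of \<open>(S\<^sub>1, \<dots>, S\<^sub>r)\<close> and \<open>(X\<^sub>1, \<dots>, X\<^sub>m)\<close>, as a pair of families indexed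
  by \<^term>\<open>{1..r}\<close> and \<^term>\<open>{1..m}\<close>; the values outside of these index sets are
  irrelevant and set to 0.
\<close>

definition random_points ::
    "nat \<Rightarrow> nat \<Rightarrow> nat \<Rightarrow> ((nat \<Rightarrow> nat \<Rightarrow>\<^sub>0 real) \<times> (nat \<Rightarrow> nat \<Rightarrow>\<^sub>0 real)) pmf" where
  "random_points d r m = pair_pmf (random_vertices d r) (random_vertices d m)"

end

theory Submission
  imports Defs "HOL-Combinatorics.Transposition" "HOL-Real_Asymp.Real_Asymp"
begin

text \<open>
  Let \<open>b\<close> be the barycentre of \<open>S\<close> and \<open>F\<close> the smallest face of the cube that contains \<open>S\<close>. With high
  probability each of the \<open>2 ^ r\<close> possible columns \<open>(S\<^sub>1 j, \<dots>, S\<^sub>r j)\<close> occurs about \<open>d / 2 ^ r\<close> times, so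
  that the entropies of the coordinates of \<open>b\<close> add up to about \<open>(1 - \<tau>) d\<close>, where \<open>\<tau>\<close> is the
  threshold exponent.

  A vertex \<open>x\<close> of \<open>F\<close> has probability \<open>2 powr (c \<bullet> (x - b) - H)\<close> under the product Bernoulli
  distribution with mean \<open>b\<close>, where \<open>c\<close> is the vector of log-odds of \<open>b\<close> and \<open>H\<close> its total entropy.
  Hence at most about \<open>2 powr H\<close> vertices of \<open>F\<close> satisfy \<open>c \<bullet> (x - b) \<ge> 0\<close>. A slight perturbation
  of \<open>c\<close> is constant on \<open>S\<close>; below the threshold no point of \<open>X\<close> lies in the corresponding halfspace,
  so that \<open>conv S\<close> is a face.

  Conversely, every halfspace with \<open>b\<close> on its boundary contains at least \<open>2 powr (H - o(d))\<close> typical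
  vertices of \<open>F\<close>. Above the threshold a union bound over a grid of normal vectors shows that \<open>b\<close>
  lies in \<open>conv (X - S)\<close>. As \<open>S\<close> contains all cube vertices in \<open>aff S\<close>, the intersection
  with \<open>aff S\<close> is then not a face.
\<close>

section \<open>Faces and separation\<close>

lemma lookup_scaleR [simp]:
  "Poly_Mapping.lookup (c *\<^sub>R (x :: 'a \<Rightarrow>\<^sub>0 real)) i = c * Poly_Mapping.lookup x i"
  by (simp add: scaleR_poly_mapping_def)

definition lin :: "nat \<Rightarrow> (nat \<Rightarrow> real) \<Rightarrow> (nat \<Rightarrow>\<^sub>0 real) \<Rightarrow> real" where
  "lin d c x = (\<Sum>j<d. c j * Poly_Mapping.lookup x j)"

lemma linear_lin: "linear (lin d c)"
  by (rule linearI)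
     (simp_all add: lin_def lookup_add algebra_simps sum.distrib sum_distrib_left)

text \<open>A supporting hyperplane argument: the open halfspace \<open>\<beta> < f x\<close>
  together with \<open>convex hull S\<close> is a convex set that contains
  \<open>X \<union> S\<close>, so the hull of the union meets the hyperplane only in
  \<open>convex hull S\<close>.\<close>

lemma face_of_convex_hull_Un:
  fixes f :: "'a::real_vector \<Rightarrow> real"
  assumes f: "linear f" and S: "\<And>s. s \<in> S \<Longrightarrow> f s = \<beta>" and X: "\<And>x. x \<in> X \<Longrightarrow> \<beta> < f x"
  shows "convex hull S face_of convex hull (X \<union> S)"
proof -
  have lc: "f (u *\<^sub>R x + v *\<^sub>R y) = u * f x + v * f y" for u v x y
    using f by (simp add: linear_add linear_scale)
  have hS: "f s = \<beta>" if "s \<in> convex hull S" for s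
  proof -
    have "convex (f -` {\<beta>})" by (rule convex_linear_vimage[OF f]) simp
    hence "convex hull S \<subseteq> f -` {\<beta>}" by (intro hull_minimal) (use S in auto)
    thus ?thesis using that by auto
  qed
  let ?Q = "{x. \<beta> < f x} \<union> convex hull S"
  have ge: "f x \<ge> \<beta>" if "x \<in> ?Q" for x
    using that hS by fastforce
  have gt: "\<beta> < u * a + v * b" if "a \<ge> \<beta>" "b \<ge> \<beta>" "a > \<beta> \<and> u > 0 \<or> b > \<beta> \<and> v > 0" "u \<ge> 0" "v \<ge> 0" "u + v = 1"
    for u v a b :: real
  proof -
    have "u * (a - \<beta>) + v * (b - \<beta>) > 0"
      using that by (smt (verit) mult_nonneg_nonneg mult_pos_pos)
    moreover have "u * \<beta> + v * \<beta> = \<beta>" using that(6) by (metis distrib_right mult_1)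
    ultimately show ?thesis by (simp add: algebra_simps)
  qed
  have "convex ?Q"
  proof (rule convexI)
    fix x y u v :: _ assume xy: "x \<in> ?Q" "y \<in> ?Q" and uv: "0 \<le> (u::real)" "0 \<le> v" "u + v = 1"
    show "u *\<^sub>R x + v *\<^sub>R y \<in> ?Q"
    \<comment> \<open>A combination rises above \<open>\<beta>\<close> as soon as an endpoint above
      it has positive weight; otherwise every endpoint of positive weight lies in
      \<open>convex hull S\<close>.\<close>
    proof (cases "f x > \<beta> \<and> u > 0 \<or> f y > \<beta> \<and> v > 0")
      case True
      thus ?thesis using gt[OF ge[OF xy(1)] ge[OF xy(2)] _ uv] by (auto simp: lc)
    next
      case False
      consider "u = 0" "v = 1" | "v = 0" "u = 1" | "u > 0" "v > 0" using uv by fastforce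
      thus ?thesis
      proof cases
        case 3
        hence "x \<in> convex hull S" "y \<in> convex hull S" using False xy by auto
        thus ?thesis using uv convex_convex_hull by (auto intro: convexD)
      qed (use xy in auto)
    qed
  qed
  moreover have "X \<union> S \<subseteq> ?Q" using X by (auto intro: hull_inc)
  ultimately have P: "convex hull (X \<union> S) \<subseteq> ?Q" by (rule hull_minimal[rotated])
  show ?thesis unfolding face_of_def
  proof (intro conjI ballI impI)
    show "convex hull S \<subseteq> convex hull (X \<union> S)" by (rule hull_mono) auto
    fix a b x assume *: "a \<in> convex hull (X \<union> S)" "b \<in> convex hull (X \<union> S)"
      "x \<in> convex hull S" "x \<in> open_segment a b"
    then obtain u where u: "0 < u" "u < 1" "x = (1 - u) *\<^sub>R a + u *\<^sub>R b"
      by (auto simp: in_segment)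
    have fx: "f x = \<beta>" using * hS by auto
    have "\<not> (f a > \<beta> \<or> f b > \<beta>)"
      using gt[of "f a" "f b" "1 - u" u] ge * P u fx by (auto simp: lc subset_iff)
    thus "a \<in> convex hull S" "b \<in> convex hull S" using * P by auto
  qed auto
qed

text \<open>If a segment between two points outside \<open>T\<close> had a relative interior point
  in \<open>T\<close>, the face property would put both of its ends into \<open>T\<close>.\<close>

lemma convex_Diff_face:
  assumes "T face_of P" "convex P"
  shows "convex (P - T)"
proof (rule convexI)
  fix x y u v assume xy: "x \<in> P - T" "y \<in> P - T" and uv: "0 \<le> (u::real)" "0 \<le> v" "u + v = 1"
  let ?z = "u *\<^sub>R x + v *\<^sub>R y"
  have "?z \<in> P" using xy uv assms(2) by (auto intro: convexD)
  moreover have "?z \<notin> T"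
  proof
    assume z: "?z \<in> T"
    consider "u = 0" "v = 1" | "v = 0" "u = 1" | "x = y" | "u > 0" "v > 0" "x \<noteq> y" using uv by fastforce
    thus False
    proof cases
      case 3
      thus False using z xy uv by (metis DiffD2 scaleR_collapse add_diff_cancel_left' add.commute)
    next
      case 4
      hence "?z \<in> open_segment x y" using uv
        by (auto simp: in_segment intro!: exI[of _ v] arg_cong2[where f = "(+)"])
      thus False using assms(1) z xy by (auto dest: face_ofD)
    qed (use z xy in auto)
  qed
  ultimately show "?z \<in> P - T" by simp
qed

text \<open>The metric sums the coordinate distances over both supports, so each coordinate is
  1-Lipschitz and hence continuous.\<close>

lemma dist_lookup_le:
  "dist (Poly_Mapping.lookup x j) (Poly_Mapping.lookup y j) \<le> dist x (y :: 'a \<Rightarrow>\<^sub>0 real)"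
proof (cases "j \<in> Poly_Mapping.keys x \<union> Poly_Mapping.keys y")
  case True
  thus ?thesis unfolding dist_poly_mapping_def by (intro member_le_sum) auto
next
  case False
  thus ?thesis by (simp add: in_keys_iff)
qed

lemma continuous_on_lookup: "continuous_on A (\<lambda>x :: 'a \<Rightarrow>\<^sub>0 real. Poly_Mapping.lookup x j)"
  unfolding continuous_on_iff by (meson dist_lookup_le le_less_trans)

lemma keys_convex_hull:
  assumes "\<And>x. x \<in> X \<Longrightarrow> Poly_Mapping.keys (x :: 'a \<Rightarrow>\<^sub>0 real) \<subseteq> D" "w \<in> convex hull X"
  shows "Poly_Mapping.keys w \<subseteq> D"
proof -
  have "convex {x :: 'a \<Rightarrow>\<^sub>0 real. Poly_Mapping.keys x \<subseteq> D}"
    by (rule convexI) (auto simp: in_keys_iff lookup_add subset_iff, metis add.right_neutral mult_zero_right)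
  hence "convex hull X \<subseteq> {x. Poly_Mapping.keys x \<subseteq> D}"
    by (intro hull_minimal) (use assms in auto)
  thus ?thesis using assms(2) by auto
qed

text \<open>
  The ambient space is not Euclidean, so the nearest point is found by minimising the
  coordinatewise quadratic form over the compact convex hull.
\<close>

lemma separating_functional:
  assumes "finite X" "\<And>x. x \<in> X \<Longrightarrow> Poly_Mapping.keys x \<subseteq> {..<d}"
    and b: "Poly_Mapping.keys b \<subseteq> {..<d}" "b \<notin> convex hull X"
  shows "\<exists>c. \<forall>x\<in>X. lin d c x < lin d c b"
proof (cases "X = {}")
  case False
  let ?l = "Poly_Mapping.lookup"
  define q where "q = (\<lambda>y. \<Sum>j<d. (?l y j - ?l b j)\<^sup>2)"
  have "continuous_on (convex hull X) q"
    unfolding q_def by (intro continuous_intros continuous_on_lookup)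
  moreover have "compact (convex hull X)" by (rule finite_imp_compact_convex_hull) fact
  ultimately obtain w where w: "w \<in> convex hull X" "\<And>y. y \<in> convex hull X \<Longrightarrow> q w \<le> q y"
    using continuous_attains_inf[of "convex hull X" q] False by auto
  \<comment> \<open>The normal vector points from the nearest point \<open>w\<close> to
    \<open>b\<close>.\<close>
  define c where "c = (\<lambda>j. ?l b j - ?l w j)"
  have "w \<noteq> b" using w b by auto
  then obtain j where j: "?l w j \<noteq> ?l b j" by (metis poly_mapping_eqI)
  have "Poly_Mapping.keys w \<subseteq> {..<d}" using keys_convex_hull assms(2) w(1) by blast
  hence "j < d" using j b by (metis in_keys_iff lessThan_iff subsetD)
  hence "0 < (\<Sum>j<d. (c j)\<^sup>2)" using j by (intro sum_pos2[of _ j]) (auto simp: c_def)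
  also have "\<dots> = lin d c b - lin d c w"
    by (simp add: lin_def c_def power2_eq_square algebra_simps flip: sum_subtractf)
  finally have wb: "lin d c w < lin d c b" by simp
  have "lin d c x \<le> lin d c w" if x: "x \<in> X" for x
  proof (rule ccontr)
    assume neg: "\<not> ?thesis"
    define a where "a = lin d c x - lin d c w"
    define e where "e = (\<Sum>j<d. (?l x j - ?l w j)\<^sup>2)"
    have a: "a > 0" using neg by (simp add: a_def)
    have e: "e \<ge> 0" unfolding e_def by (intro sum_nonneg) auto
    \<comment> \<open>Moving from \<open>w\<close> towards \<open>x\<close> by \<open>t\<close>
      changes \<open>q\<close> by \<open>- 2 * t * a + t^2 * e\<close>. This \<open>t\<close> is
      small enough to make the change negative, and at most 1 to stay in the hull; the
      \<open>+ 1\<close> covers \<open>e = 0\<close>.\<close>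
    define t where "t = min 1 (a / (e + 1))"
    have "t \<le> a / (e + 1)" "e + 1 > 0" using e by (auto simp: t_def)
    hence "t * (e + 1) \<le> a" using pos_le_divide_eq by blast
    hence t: "0 < t" "t \<le> 1" "t * (e + 1) \<le> a" using a e by (auto simp: t_def)
    have "(1 - t) *\<^sub>R w + t *\<^sub>R x \<in> convex hull X"
      using t w x by (intro convexD convex_convex_hull) (auto intro: hull_inc)
    from w(2)[OF this] have "q w \<le> q ((1 - t) *\<^sub>R w + t *\<^sub>R x)" .
    also have "\<dots> = q w - 2 * t * a + t\<^sup>2 * e"
      unfolding q_def a_def e_def lin_def sum_distrib_left sum_subtractf[symmetric] sum.distrib[symmetric]
      by (rule sum.cong) (simp_all add: c_def lookup_add lookup_minus power2_eq_square algebra_simps)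
    finally have "t * (2 * a) \<le> t * (t * e)" by (simp add: power2_eq_square)
    hence "2 * a \<le> t * e" using t by simp
    thus False using t a by (simp add: algebra_simps)
  qed
  hence "\<forall>x\<in>X. lin d c x < lin d c b" using wb by (meson le_less_trans)
  thus ?thesis by blast
qed auto

section \<open>Product Bernoulli weights on the cube\<close>

text \<open>Expanding the product gives one term for each subset of \<open>{..<d}\<close>, and
  taking supports identifies the cube vertices with these subsets. Sums of product functions over
  the cube thereby factorise.\<close>

lemma sum_cube_prod:
  fixes g :: "nat \<Rightarrow> real \<Rightarrow> real"
  shows "(\<Sum>x\<in>cube_vertices d. \<Prod>j<d. g j (Poly_Mapping.lookup x j)) = (\<Prod>j<d. g j 0 + g j 1)"
proof -
  have "(\<Prod>j<d. g j 0 + g j 1) = (\<Prod>j<d. g j 1 + g j 0)" by (simp add: add.commute)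
  also have "\<dots> = (\<Sum>A\<in>Pow {..<d}. (\<Prod>j\<in>A. g j 1) * (\<Prod>j\<in>{..<d} - A. g j 0))"
    by (rule prod_add) simp
  also have "\<dots> = (\<Sum>x\<in>cube_vertices d. (\<Prod>j\<in>Poly_Mapping.keys x. g j 1) *
      (\<Prod>j\<in>{..<d} - Poly_Mapping.keys x. g j 0))"
    by (rule sum.reindex_bij_betw[OF cube_vertices_bij_betw, symmetric])
  also have "\<dots> = (\<Sum>x\<in>cube_vertices d. \<Prod>j<d. g j (Poly_Mapping.lookup x j))"
  proof (rule sum.cong)
    fix x assume x: "x \<in> cube_vertices d"
    hence k: "Poly_Mapping.keys x \<subseteq> {..<d}" by (auto simp: cube_vertices_def)
    have "(\<Prod>j\<in>Poly_Mapping.keys x. g j 1) = (\<Prod>j\<in>Poly_Mapping.keys x. g j (Poly_Mapping.lookup x j))"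
      using x k by (intro prod.cong) (auto simp: cube_vertices_def in_keys_iff dest!: subsetD)
    moreover have "(\<Prod>j\<in>{..<d} - Poly_Mapping.keys x. g j 0) =
        (\<Prod>j\<in>{..<d} - Poly_Mapping.keys x. g j (Poly_Mapping.lookup x j))"
      by (intro prod.cong) (auto simp: in_keys_iff)
    ultimately show "(\<Prod>j\<in>Poly_Mapping.keys x. g j 1) * (\<Prod>j\<in>{..<d} - Poly_Mapping.keys x. g j 0)
        = (\<Prod>j<d. g j (Poly_Mapping.lookup x j))"
      using prod.subset_diff[OF k, of "\<lambda>j. g j (Poly_Mapping.lookup x j)"] by (simp add: mult.commute)
  qed simp
  finally show ?thesis by simp
qed

lemma lookup_cube:
  assumes "x \<in> cube_vertices d"
  shows "Poly_Mapping.lookup x j = 0 \<or> Poly_Mapping.lookup x j = 1"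
  using assms by (cases "j < d") (auto simp: cube_vertices_def in_keys_iff)

definition bernoulli_weight :: "nat \<Rightarrow> (nat \<Rightarrow> real) \<Rightarrow> (nat \<Rightarrow>\<^sub>0 real) \<Rightarrow> real" where
  "bernoulli_weight d b x = (\<Prod>j<d. if Poly_Mapping.lookup x j = 1 then b j else 1 - b j)"

lemma bernoulli_weight_nonneg:
  "(\<And>j. j < d \<Longrightarrow> 0 \<le> b j \<and> b j \<le> 1) \<Longrightarrow> 0 \<le> bernoulli_weight d b x"
  unfolding bernoulli_weight_def by (intro prod_nonneg) auto

lemma sum_bernoulli_weight: "(\<Sum>x\<in>cube_vertices d. bernoulli_weight d b x) = 1"
  using sum_cube_prod[of "\<lambda>j t. if t = 1 then b j else 1 - b j" d]
  by (simp add: bernoulli_weight_def)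

lemma sum_bernoulli_weight_lookup:
  assumes "i < d"
  shows "(\<Sum>x\<in>cube_vertices d. bernoulli_weight d b x * Poly_Mapping.lookup x i) = b i"
proof -
  \<comment> \<open>The single coordinate is written as a product over all \<open>j\<close> whose
    factors are 1 except at \<open>i\<close>, so that the sum factorises.\<close>
  have "bernoulli_weight d b x * Poly_Mapping.lookup x i =
     (\<Prod>j<d. (if Poly_Mapping.lookup x j = 1 then b j else 1 - b j) *
       (if j = i then Poly_Mapping.lookup x j else 1))" for x
    using assms by (simp add: bernoulli_weight_def prod.distrib prod.delta)
  hence "(\<Sum>x\<in>cube_vertices d. bernoulli_weight d b x * Poly_Mapping.lookup x i) =
     (\<Prod>j<d. (1 - b j) * (if j = i then 0 else 1) + b j * (if j = i then 1 else 1))"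
    using sum_cube_prod[of "\<lambda>j t. (if t = 1 then b j else 1 - b j) * (if j = i then t else 1)" d]
    by (simp cong: if_cong)
  also have "\<dots> = (\<Prod>j<d. if j = i then b j else 1)"
    by (intro prod.cong) auto
  finally show ?thesis using assms by (simp add: prod.delta)
qed

text \<open>Linearity of expectation. The centre \<open>a\<close> is kept apart from the mean
  \<open>b\<close>, because the functional stays centred at the barycentre when one coordinate of
  the mean is altered.\<close>

lemma sum_bernoulli_weight_linear:
  "(\<Sum>x\<in>cube_vertices d. bernoulli_weight d b x * (\<Sum>j<d. c j * (Poly_Mapping.lookup x j - a j))) =
    (\<Sum>j<d. c j * (b j - a j))"
proof -
  have "(\<Sum>x\<in>cube_vertices d. bernoulli_weight d b x * (\<Sum>j<d. c j * (Poly_Mapping.lookup x j - a j))) =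
     (\<Sum>j<d. c j * (\<Sum>x\<in>cube_vertices d. bernoulli_weight d b x * Poly_Mapping.lookup x j) -
       c j * a j * (\<Sum>x\<in>cube_vertices d. bernoulli_weight d b x))"
    unfolding sum_distrib_left sum_subtractf[symmetric]
    by (subst sum.swap) (simp add: algebra_simps)
  also have "\<dots> = (\<Sum>j<d. c j * (b j - a j))"
    by (intro sum.cong refl) (simp add: sum_bernoulli_weight sum_bernoulli_weight_lookup right_diff_distrib)
  finally show ?thesis .
qed

section \<open>A Chernoff bound for product Bernoulli weights\<close>

lemma exp_le_quadratic:
  assumes "\<bar>u :: real\<bar> \<le> 1"
  shows "exp u \<le> 1 + u + u\<^sup>2"
proof (cases "u \<ge> 0")
  case True
  thus ?thesis using exp_bound[of u] assms by simp
next
  case False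
  define v where "v = - u"
  have v: "v > 0" using False by (simp add: v_def)
  \<comment> \<open>As \<open>exp v\<close> dominates its quadratic Taylor polynomial, it suffices
    to multiply the claimed bound by that polynomial.\<close>
  have "1 \<le> (1 - v + v\<^sup>2) * (1 + v + v\<^sup>2 / 2)"
  proof -
    have "(1 - v + v\<^sup>2) * (1 + v + v\<^sup>2 / 2) = 1 + v^2/2 + v^3/2 + v^4/2"
      by (simp add: field_simps power2_eq_square power3_eq_cube power4_eq_xxxx)
    thus ?thesis using v by simp
  qed
  also have "\<dots> \<le> (1 - v + v\<^sup>2) * exp v"
  proof (rule mult_left_mono)
    show "1 + v + v\<^sup>2 / 2 \<le> exp v" using exp_lower_Taylor_quadratic[of v] v by simp
    show "0 \<le> 1 - v + v\<^sup>2"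
      using assms by (simp add: v_def)
  qed
  finally have "exp (- v) \<le> 1 - v + v\<^sup>2"
    by (simp add: exp_minus field_simps)
  thus ?thesis by (simp add: v_def)
qed

text \<open>In the quadratic bound for \<open>exp\<close> the linear terms cancel, since the
  variable is centred, and \<open>p * (1 - p)\<close> is at most 1.\<close>

lemma bernoulli_mgf_le:
  fixes p c :: real
  assumes p: "0 \<le> p" "p \<le> 1" and c: "\<bar>c\<bar> \<le> 1"
  shows "(1 - p) * exp (c * (0 - p)) + p * exp (c * (1 - p)) \<le> exp (c\<^sup>2)"
proof -
  have "\<bar>c * (0 - p)\<bar> \<le> 1" "\<bar>c * (1 - p)\<bar> \<le> 1"
    using p c by (auto simp: abs_mult intro: mult_le_one)
  note this[THEN exp_le_quadratic]
  hence "(1 - p) * exp (c * (0 - p)) + p * exp (c * (1 - p)) \<le>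
     (1 - p) * (1 + c * (0 - p) + (c * (0 - p))\<^sup>2) + p * (1 + c * (1 - p) + (c * (1 - p))\<^sup>2)"
    using p by (intro add_mono mult_left_mono) auto
  also have "\<dots> = 1 + c\<^sup>2 * (p * (1 - p))"
    by (simp add: power2_eq_square algebra_simps)
  also have "\<dots> \<le> 1 + c\<^sup>2 * 1"
    using p by (intro add_left_mono mult_left_mono) (auto intro: mult_le_one)
  also have "\<dots> \<le> exp (c\<^sup>2)" using exp_ge_add_one_self[of "c\<^sup>2"] by simp
  finally show ?thesis .
qed

text \<open>Markov's inequality for the exponential of \<open>l\<close> times the centred sum; its
  expectation factorises over the coordinates.\<close>

lemma bernoulli_weight_chernoff:
  assumes b: "\<And>j. j < d \<Longrightarrow> 0 \<le> b j \<and> b j \<le> 1" and c: "\<And>j. j < d \<Longrightarrow> \<bar>c j\<bar> \<le> L"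
    and \<delta>: "0 < \<delta>" "\<delta> \<le> 2 * L"
  shows "(\<Sum>x\<in>{x \<in> cube_vertices d. \<delta> * real d \<le> (\<Sum>j<d. c j * (Poly_Mapping.lookup x j - b j))}.
      bernoulli_weight d b x) \<le> exp (- (\<delta>\<^sup>2 / (4 * L\<^sup>2)) * real d)"
proof -
  \<comment> \<open>This value minimises \<open>- l * \<delta> + (l * L)^2\<close>; the assumption
    \<open>\<delta> \<le> 2 * L\<close> turns into \<open>l * L \<le> 1\<close>, which
    \<open>bernoulli_mgf_le\<close> needs.\<close>
  define l where "l = \<delta> / (2 * L\<^sup>2)"
  have L: "L > 0" using \<delta> by simp
  have l: "l > 0" "l * L \<le> 1" using L \<delta> by (auto simp: l_def power2_eq_square field_simps)
  let ?Z = "\<lambda>x. \<Sum>j<d. c j * (Poly_Mapping.lookup x j - b j)"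
  have nn: "0 \<le> bernoulli_weight d b x" for x by (rule bernoulli_weight_nonneg[OF b])
  have e: "exp (l * (z - \<delta> * d)) = exp (- l * \<delta> * d) * exp (l * z)" for z
    by (simp add: algebra_simps flip: exp_add)
  have "(\<Sum>x\<in>{x \<in> cube_vertices d. \<delta> * real d \<le> ?Z x}. bernoulli_weight d b x) \<le>
    (\<Sum>x\<in>{x \<in> cube_vertices d. \<delta> * real d \<le> ?Z x}. bernoulli_weight d b x * exp (l * (?Z x - \<delta> * d)))"
    using l mult_left_mono[OF one_le_exp_iff[THEN iffD2] nn] by (intro sum_mono) auto
  also have "\<dots> \<le> (\<Sum>x\<in>cube_vertices d. bernoulli_weight d b x * exp (l * (?Z x - \<delta> * d)))"
    using nn by (intro sum_mono2) (auto simp: finite_cube_vertices)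
  also have "\<dots> = exp (- l * \<delta> * d) * (\<Sum>x\<in>cube_vertices d. bernoulli_weight d b x * exp (l * ?Z x))"
    unfolding e sum_distrib_left by (intro sum.cong) (simp_all only: mult_ac)
  also have "(\<Sum>x\<in>cube_vertices d. bernoulli_weight d b x * exp (l * ?Z x)) =
     (\<Sum>x\<in>cube_vertices d. \<Prod>j<d. (if Poly_Mapping.lookup x j = 1 then b j else 1 - b j) *
       exp (l * c j * (Poly_Mapping.lookup x j - b j)))"
    by (simp add: bernoulli_weight_def prod.distrib exp_sum sum_distrib_left mult.assoc)
  also have "\<dots> = (\<Prod>j<d. (1 - b j) * exp (l * c j * (0 - b j)) + b j * exp (l * c j * (1 - b j)))"
    using sum_cube_prod[of "\<lambda>j t. (if t = 1 then b j else 1 - b j) * exp (l * c j * (t - b j))" d] by simp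
  also have "\<dots> \<le> (\<Prod>j<d. exp ((l * L)\<^sup>2))"
  proof (intro prod_mono conjI)
    fix j assume "j \<in> {..<d}"
    hence j: "j < d" by simp
    have lc: "\<bar>l * c j\<bar> \<le> l * L" using c[OF j] l by (simp add: abs_mult)
    have "(1 - b j) * exp (l * c j * (0 - b j)) + b j * exp (l * c j * (1 - b j)) \<le> exp ((l * c j)\<^sup>2)"
      using b[OF j] lc l by (intro bernoulli_mgf_le) auto
    also have "\<dots> \<le> exp ((l * L)\<^sup>2)" using lc L l by (simp add: abs_le_square_iff[symmetric])
    finally show "(1 - b j) * exp (l * c j * (0 - b j)) + b j * exp (l * c j * (1 - b j)) \<le> exp ((l * L)\<^sup>2)" .
    show "0 \<le> (1 - b j) * exp (l * c j * (0 - b j)) + b j * exp (l * c j * (1 - b j))"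
      using b[OF j] by (intro add_nonneg_nonneg mult_nonneg_nonneg) auto
  qed
  also have "\<dots> = exp (d * (l * L)\<^sup>2)" by (simp add: exp_of_nat_mult)
  also have "exp (- l * \<delta> * d) * exp (d * (l * L)\<^sup>2) = exp (- (\<delta>\<^sup>2 / (4 * L\<^sup>2)) * real d)"
    unfolding exp_add[symmetric] using L by (simp add: l_def power2_eq_square field_simps)
  finally show ?thesis by simp
qed

section \<open>Log-odds and the number of vertices in a halfspace\<close>

definition log_odds :: "real \<Rightarrow> real" where
  "log_odds p = log 2 (p / (1 - p))"

text \<open>
  For \<open>p \<in> {0, 1}\<close> the junk values of division and logarithm make \<open>log_odds p\<close> and
  \<open>binary_entropy p\<close> vanish, which is the correct convention here.
\<close>

lemma bernoulli_factor_eq: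
  assumes "0 \<le> p" "p \<le> 1" "x = 0 \<or> x = 1" "p = 0 \<Longrightarrow> x = 0" "p = 1 \<Longrightarrow> x = 1"
  shows "(if x = 1 then p else 1 - p) = 2 powr (log_odds p * (x - p) - binary_entropy p)"
proof (cases "p = 0 \<or> p = 1")
  case True
  thus ?thesis using assms by (auto simp: log_odds_def binary_entropy_def)
next
  case False
  hence p: "0 < p" "p < 1" using assms by auto
  have "log_odds p * (x - p) - binary_entropy p = log 2 (if x = 1 then p else 1 - p)"
    using p assms(3) by (auto simp: log_odds_def binary_entropy_def log_divide algebra_simps)
  thus ?thesis using p by simp
qed

text \<open>For \<open>b\<close> in the cube this describes its smallest face around
  \<open>b\<close>: the coordinates where \<open>b\<close> is 0 or 1 are fixed, the others are
  free.\<close>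

definition in_face :: "nat \<Rightarrow> (nat \<Rightarrow> real) \<Rightarrow> (nat \<Rightarrow>\<^sub>0 real) \<Rightarrow> bool" where
  "in_face d b x \<longleftrightarrow> (\<forall>j<d. (b j = 0 \<longrightarrow> Poly_Mapping.lookup x j = 0) \<and> (b j = 1 \<longrightarrow> Poly_Mapping.lookup x j = 1))"

lemma bernoulli_weight_eq:
  assumes b: "\<And>j. j < d \<Longrightarrow> 0 \<le> b j \<and> b j \<le> 1" and "x \<in> cube_vertices d" "in_face d b x"
  shows "bernoulli_weight d b x =
    2 powr ((\<Sum>j<d. log_odds (b j) * (Poly_Mapping.lookup x j - b j)) - (\<Sum>j<d. binary_entropy (b j)))"
proof -
  have "bernoulli_weight d b x =
      (\<Prod>j<d. 2 powr (log_odds (b j) * (Poly_Mapping.lookup x j - b j) - binary_entropy (b j)))"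
    unfolding bernoulli_weight_def
    using assms by (intro prod.cong bernoulli_factor_eq) (auto simp: in_face_def lookup_cube)
  thus ?thesis unfolding sum_subtractf[symmetric] by (simp add: powr_sum)
qed

lemma bernoulli_weight_eq_0:
  assumes "x \<in> cube_vertices d" "\<not> in_face d b x"
  shows "bernoulli_weight d b x = 0"
proof -
  obtain j where j: "j < d" "b j = 0 \<and> Poly_Mapping.lookup x j = 1 \<or> b j = 1 \<and> Poly_Mapping.lookup x j = 0"
    using assms lookup_cube unfolding in_face_def by blast
  thus ?thesis unfolding bernoulli_weight_def by (intro prod_zero bexI[of _ j]) auto
qed

text \<open>Each counted vertex has weight at least \<open>2 powr (- t - H)\<close>, where
  \<open>H\<close> is the total entropy, and all weights add up to 1.\<close>

lemma card_log_odds_ge: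
  assumes b: "\<And>j. j < d \<Longrightarrow> 0 \<le> b j \<and> b j \<le> 1"
  shows "real (card {x \<in> cube_vertices d. in_face d b x \<and>
      - t \<le> (\<Sum>j<d. log_odds (b j) * (Poly_Mapping.lookup x j - b j))})
    \<le> 2 powr ((\<Sum>j<d. binary_entropy (b j)) + t)" (is "real (card ?B) \<le> 2 powr (?H + t)")
proof -
  have "real (card ?B) * 2 powr (- t - ?H) = (\<Sum>x\<in>?B. 2 powr (- t - ?H))" by simp
  also have "\<dots> \<le> (\<Sum>x\<in>?B. bernoulli_weight d b x)"
    by (intro sum_mono) (auto simp: bernoulli_weight_eq[OF b])
  also have "\<dots> \<le> (\<Sum>x\<in>cube_vertices d. bernoulli_weight d b x)"
    by (intro sum_mono2) (auto simp: finite_cube_vertices bernoulli_weight_nonneg[OF b])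
  finally have "real (card ?B) * 2 powr (- t - ?H) \<le> 1"
    by (simp add: sum_bernoulli_weight)
  hence "real (card ?B) * 2 powr (- t - ?H) * 2 powr (?H + t) \<le> 1 * 2 powr (?H + t)"
    by (rule mult_right_mono) simp
  thus ?thesis by (simp add: mult.assoc flip: powr_add)
qed

section \<open>Column types\<close>

text \<open>A column of the matrix with rows \<open>s 1, ..., s r\<close>, encoded as the set of
  rows with entry 1.\<close>

definition col :: "nat \<Rightarrow> (nat \<Rightarrow> nat \<Rightarrow>\<^sub>0 real) \<Rightarrow> nat \<Rightarrow> nat set" where
  "col r s j = {i \<in> {1..r}. Poly_Mapping.lookup (s i) j = 1}"

definition col_count :: "nat \<Rightarrow> nat \<Rightarrow> (nat \<Rightarrow> nat \<Rightarrow>\<^sub>0 real) \<Rightarrow> nat set \<Rightarrow> nat" where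
  "col_count d r s A = card {j \<in> {..<d}. col r s j = A}"

definition bary :: "nat \<Rightarrow> (nat \<Rightarrow> nat \<Rightarrow>\<^sub>0 real) \<Rightarrow> nat \<Rightarrow> real" where
  "bary r s j = real (card (col r s j)) / real r"

text \<open>The error is relative to the expected count \<open>d / 2 ^ r\<close> of a column type.
  Membership in the cube is included because \<open>col\<close> only records which entries equal
  1.\<close>

definition balanced :: "real \<Rightarrow> nat \<Rightarrow> nat \<Rightarrow> (nat \<Rightarrow> nat \<Rightarrow>\<^sub>0 real) \<Rightarrow> bool" where
  "balanced \<delta> d r s \<longleftrightarrow> (\<forall>i\<in>{1..r}. s i \<in> cube_vertices d) \<and>
     (\<forall>A\<in>Pow {1..r}. \<bar>real (col_count d r s A) - real d / 2 ^ r\<bar> \<le> \<delta> * (real d / 2 ^ r))"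

text \<open>The expected entropy of a barycentre coordinate whose column is uniformly distributed;
  this is the complement of the threshold exponent to 1.\<close>

definition type_entropy :: "nat \<Rightarrow> real" where
  "type_entropy r = (\<Sum>A\<in>Pow {1..r}. binary_entropy (real (card A) / real r)) / 2 ^ r"

lemma col_subset: "col r s j \<subseteq> {1..r}"
  by (auto simp: col_def)

lemma card_col_le: "card (col r s j) \<le> r"
  using card_mono[OF _ col_subset, of r s j] by simp

lemma bary_bounds: "0 \<le> bary r s j" "bary r s j \<le> 1"
  using card_col_le[of r s j] by (auto simp: bary_def divide_le_eq)

lemma sum_col:
  fixes f :: "nat set \<Rightarrow> real"
  shows "(\<Sum>j<d. f (col r s j)) = (\<Sum>A\<in>Pow {1..r}. real (col_count d r s A) * f A)"
proof -
  have "(\<Sum>j<d. f (col r s j)) = (\<Sum>A\<in>Pow {1..r}. \<Sum>j\<in>{j \<in> {..<d}. col r s j = A}. f (col r s j))"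
    by (rule sum.group[symmetric]) (use col_subset in auto)
  also have "\<dots> = (\<Sum>A\<in>Pow {1..r}. \<Sum>j\<in>{j \<in> {..<d}. col r s j = A}. f A)"
    by (intro sum.cong) auto
  finally show ?thesis by (simp add: col_count_def)
qed

lemma bary_eq:
  assumes "\<And>i. i \<in> {1..r} \<Longrightarrow> s i \<in> cube_vertices d"
  shows "bary r s j = (\<Sum>i\<in>{1..r}. Poly_Mapping.lookup (s i) j) / real r"
proof -
  have "(\<Sum>i\<in>{1..r}. Poly_Mapping.lookup (s i) j) = (\<Sum>i\<in>{1..r}. if Poly_Mapping.lookup (s i) j = 1 then 1 else 0)"
    using lookup_cube[OF assms] by (intro sum.cong) auto
  also have "\<dots> = real (card (col r s j))"
    by (simp add: col_def sum.If_cases Int_def)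
  finally show ?thesis by (simp add: bary_def)
qed

text \<open>A barycentre coordinate can be 0 or 1 only if all \<open>s i\<close> have that same
  value there.\<close>

lemma in_face_bary:
  assumes "\<And>i. i \<in> {1..r} \<Longrightarrow> s i \<in> cube_vertices d" "i \<in> {1..r}"
  shows "in_face d (bary r s) (s i)"
  unfolding in_face_def
proof (intro allI impI conjI)
  fix j
  have fin: "finite (col r s j)" using finite_subset[OF col_subset] by blast
  show "Poly_Mapping.lookup (s i) j = 0" if "bary r s j = 0"
  proof -
    have "card (col r s j) = 0" using that assms(2) by (simp add: bary_def)
    hence "i \<notin> col r s j" using fin by simp
    thus ?thesis using assms(2) lookup_cube[OF assms(1)[OF assms(2)], of j] by (auto simp: col_def)
  qed
  show "Poly_Mapping.lookup (s i) j = 1" if "bary r s j = 1"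
  proof -
    have "card (col r s j) = r" using that assms(2) by (simp add: bary_def divide_eq_1_iff)
    hence "col r s j = {1..r}" by (intro card_subset_eq col_subset) auto
    hence "i \<in> col r s j" using assms(2) by simp
    thus ?thesis by (simp add: col_def)
  qed
qed

lemma sum_linear_bary:
  assumes "\<And>i. i \<in> {1..r} \<Longrightarrow> s i \<in> cube_vertices d" "r > 0"
    and "\<And>i. i \<in> {1..r} \<Longrightarrow> lin d c (s i) = C"
  shows "(\<Sum>j<d. c j * bary r s j) = C"
proof -
  have b: "bary r s j = (\<Sum>i\<in>{1..r}. Poly_Mapping.lookup (s i) j) / real r" for j
    by (rule bary_eq) (rule assms(1))
  have "(\<Sum>j<d. c j * bary r s j) = (\<Sum>i\<in>{1..r}. lin d c (s i)) / real r"
    unfolding lin_def b by (subst sum.swap) (simp add: sum_divide_distrib sum_distrib_left)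
  also have "\<dots> = C" using assms by simp
  finally show ?thesis .
qed

section \<open>Entropy of the column types\<close>

lemma sum_Pow_card:
  fixes f :: "nat \<Rightarrow> real"
  shows "(\<Sum>A\<in>Pow {1..r}. f (card A)) = (\<Sum>k=0..r. real (r choose k) * f k)"
proof -
  have "(\<Sum>A\<in>Pow {1..r}. f (card A)) = (\<Sum>k=0..r. \<Sum>A\<in>{A \<in> Pow {1..r}. card A = k}. f (card A))"
    by (rule sum.group[symmetric]) (auto dest: card_mono[rotated])
  also have "\<dots> = (\<Sum>k=0..r. \<Sum>A\<in>{A \<in> Pow {1..r}. card A = k}. f k)"
    by (intro sum.cong) auto
  also have "\<dots> = (\<Sum>k=0..r. real (r choose k) * f k)"
    using n_subsets[of "{1..r}"] by simp
  finally show ?thesis .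
qed

text \<open>The empty and the full column have entropy 0, and the factor
  \<open>1 - 2 powr (1 - r)\<close> cancels the denominator \<open>2 ^ r - 2\<close> of
  \<open>mean_entropy\<close>, which leaves the average over all \<open>2 ^ r\<close> types.\<close>

lemma tau_tilde_eq:
  assumes "r \<ge> 2"
  shows "tau_tilde r = 1 - type_entropy r"
proof -
  let ?h = "\<lambda>k. binary_entropy (real k / real r)"
  have h: "?h 0 = 0" "?h r = 0" using assms by (auto simp: binary_entropy_def)
  have "{0..r} = insert 0 (insert r {1..r - 1})" using assms by auto
  hence "(\<Sum>k=0..r. real (r choose k) * ?h k) = (\<Sum>k=1..r - 1. real (r choose k) * ?h k)"
    using h assms by (simp add: sum.insert_if)
  hence 1: "type_entropy r = (\<Sum>k=1..r - 1. real (r choose k) * ?h k) / 2 ^ r"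
    using sum_Pow_card[of ?h r] by (simp only: type_entropy_def)
  have "(2::real) ^ 2 \<le> 2 ^ r" using assms by (intro power_increasing) auto
  hence r4: "(2::real) ^ r \<noteq> 2" by auto
  have "(1 - 2 powr (1 - real r)) = (2 ^ r - 2) / 2 ^ r"
    by (simp add: powr_diff powr_realpow field_simps)
  thus ?thesis using r4 by (simp add: tau_tilde_def mean_entropy_def 1)
qed

lemma binary_entropy_nonneg:
  assumes "0 \<le> p" "p \<le> 1"
  shows "0 \<le> binary_entropy p"
proof -
  have "0 \<le> x * log 2 (1 / x)" if "0 \<le> x" "x \<le> 1" for x :: real
    using that by (cases "x = 0") (auto simp: zero_le_log_cancel_iff)
  from this[of p] this[of "1 - p"] show ?thesis using assms by (simp add: binary_entropy_def)
qed

lemma binary_entropy_le_1: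
  assumes "0 \<le> p" "p \<le> 1"
  shows "binary_entropy p \<le> 1"
proof -
  \<comment> \<open>This is the tangent line of \<open>x * log 2 (1 / x)\<close> at
    \<open>1 / 2\<close>; on adding it up for \<open>p\<close> and \<open>1 - p\<close> the terms
    with \<open>ln 2\<close> cancel.\<close>
  have *: "x * log 2 (1 / x) \<le> x + (1 / 2 - x) / ln 2" if "0 \<le> x" for x :: real
  proof (cases "x = 0")
    case False
    hence x: "x > 0" using that by simp
    have "ln (1 / (2 * x)) \<le> 1 / (2 * x) - 1" using x by (intro ln_le_minus_one) auto
    hence "x * ln (1 / (2 * x)) \<le> x * (1 / (2 * x) - 1)" using x by (intro mult_left_mono) auto
    moreover have "ln (1 / (2 * x)) = ln (1 / x) - ln 2" using x by (simp add: ln_div ln_mult)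
    moreover have "x * (1 / (2 * x) - 1) = 1 / 2 - x" using x by (simp add: field_simps)
    ultimately have "x * (ln (1 / x) - ln 2) \<le> 1 / 2 - x" by simp
    hence "x * ln (1 / x) / ln 2 \<le> (x * ln 2 + (1 / 2 - x)) / ln 2"
      by (intro divide_right_mono) (auto simp: algebra_simps)
    thus ?thesis by (simp add: log_def add_divide_distrib)
  qed auto
  have "binary_entropy p \<le> (p + (1 / 2 - p) / ln 2) + ((1 - p) + (1 / 2 - (1 - p)) / ln 2)"
    unfolding binary_entropy_def using assms by (intro add_mono *) auto
  also have "\<dots> = 1 + ((1 / 2 - p) + (1 / 2 - (1 - p))) / ln 2"
    unfolding add_divide_distrib by simp
  finally show ?thesis by simp
qed

lemma card_ratio_bounds:
  assumes "A \<in> Pow {1..r}"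
  shows "0 \<le> real (card A) / real r" "real (card A) / real r \<le> 1"
  using assms card_mono[of "{1..r}" A] by (auto simp: divide_le_eq)

lemma type_entropy_le_1: "type_entropy r \<le> 1"
proof -
  have "(\<Sum>A\<in>Pow {1..r}. binary_entropy (real (card A) / real r)) \<le> (\<Sum>A\<in>Pow {1..r}. 1)"
    by (intro sum_mono binary_entropy_le_1 card_ratio_bounds)
  thus ?thesis by (simp add: type_entropy_def card_Pow divide_le_eq)
qed

lemma type_entropy_pos:
  assumes "r \<ge> 2"
  shows "type_entropy r > 0"
proof -
  \<comment> \<open>The column type \<open>{1}\<close> alone already has positive entropy.\<close>
  have "0 < (1 / real r) * log 2 (real r)" using assms by simp
  also have "\<dots> \<le> binary_entropy (real (card {1::nat}) / real r)"
  proof -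
    have "0 \<le> (1 - 1 / real r) * log 2 (1 / (1 - 1 / real r))"
      using assms by (intro mult_nonneg_nonneg) (auto simp: zero_le_log_cancel_iff field_simps)
    thus ?thesis by (simp add: binary_entropy_def)
  qed
  finally have "0 < (\<Sum>A\<in>Pow {1..r}. binary_entropy (real (card A) / real r))"
    using assms by (intro sum_pos2[where i = "{1}"] binary_entropy_nonneg card_ratio_bounds) auto
  thus ?thesis by (simp add: type_entropy_def)
qed

text \<open>The total entropy is a combination of the column counts with nonnegative coefficients,
  so it inherits their relative error.\<close>

lemma entropy_balanced:
  assumes "balanced \<delta> d r s"
  shows "\<bar>(\<Sum>j<d. binary_entropy (bary r s j)) - real d * type_entropy r\<bar> \<le> \<delta> * (real d * type_entropy r)"
proof -
  let ?h = "\<lambda>A. binary_entropy (real (card A) / real r)"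
  have "(\<Sum>j<d. binary_entropy (bary r s j)) - real d * type_entropy r =
      (\<Sum>A\<in>Pow {1..r}. (real (col_count d r s A) - real d / 2 ^ r) * ?h A)"
    unfolding bary_def sum_col[where f = ?h] type_entropy_def
    by (simp add: sum_subtractf sum_distrib_left sum_divide_distrib left_diff_distrib)
  also have "\<bar>\<dots>\<bar> \<le> (\<Sum>A\<in>Pow {1..r}. \<bar>(real (col_count d r s A) - real d / 2 ^ r) * ?h A\<bar>)"
    by (rule sum_abs)
  also have "\<dots> \<le> (\<Sum>A\<in>Pow {1..r}. \<delta> * (real d / 2 ^ r) * ?h A)"
  proof (rule sum_mono)
    fix A assume A: "A \<in> Pow {1..r}"
    have h: "0 \<le> ?h A" by (intro binary_entropy_nonneg card_ratio_bounds[OF A])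
    have "\<bar>real (col_count d r s A) - real d / 2 ^ r\<bar> \<le> \<delta> * (real d / 2 ^ r)"
      using assms A unfolding balanced_def by blast
    thus "\<bar>(real (col_count d r s A) - real d / 2 ^ r) * ?h A\<bar> \<le> \<delta> * (real d / 2 ^ r) * ?h A"
      using mult_right_mono[OF _ h] by (simp only: abs_mult abs_of_nonneg[OF h])
  qed
  also have "\<dots> = \<delta> * (real d * type_entropy r)"
    by (simp add: type_entropy_def sum_distrib_left sum_divide_distrib mult.assoc)
  finally show ?thesis .
qed

text \<open>The transposition of \<open>i\<close> and \<open>k\<close> permutes the subsets, keeps
  their cardinality and exchanges the two membership conditions. This symmetry makes the rescaled
  functional take the same value at all \<open>s i\<close>.\<close>

lemma sum_Pow_containing:
  fixes f :: "nat \<Rightarrow> real"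
  assumes "i \<in> {1..r}" "k \<in> {1..r}"
  shows "(\<Sum>A\<in>Pow {1..r}. if i \<in> A then f (card A) else 0) = (\<Sum>A\<in>Pow {1..r}. if k \<in> A then f (card A) else 0)"
proof (rule sum.reindex_bij_witness[where i = "(`) (Transposition.transpose i k)" and j = "(`) (Transposition.transpose i k)"])
  fix A assume "A \<in> Pow {1..r}"
  show "Transposition.transpose i k ` A \<in> Pow {1..r}"
    using \<open>A \<in> Pow {1..r}\<close> assms by (auto simp: Transposition.transpose_def)
  have "card (Transposition.transpose i k ` A) = card A"
    by (intro card_image inj_on_subset[OF inj_transpose]) auto
  moreover have "k \<in> Transposition.transpose i k ` A \<longleftrightarrow> i \<in> A"
    by (auto simp: image_iff Transposition.transpose_def)
  ultimately show "(if k \<in> Transposition.transpose i k ` A then f (card (Transposition.transpose i k ` A)) else 0)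
      = (if i \<in> A then f (card A) else 0)" by simp
qed (use assms in \<open>auto simp: image_image Transposition.transpose_def\<close>)

section \<open>Below the threshold\<close>

text \<open>For \<open>0 < k < r\<close> the odds are \<open>k / (r - k)\<close>, a quotient of
  integers between 1 and \<open>r\<close>.\<close>

lemma abs_log_odds_le:
  assumes "k \<le> r" "r \<ge> 1"
  shows "\<bar>log_odds (real k / real r)\<bar> \<le> log 2 (real r)"
proof (cases "k = 0 \<or> k = r")
  case True
  hence "log_odds (real k / real r) = 0" by (auto simp: log_odds_def log_def)
  thus ?thesis using assms by simp
next
  case False
  hence k: "0 < k" "k < r" using assms by auto
  have "(real k / real r) / (1 - real k / real r) = real k / real (r - k)"
    using k by (simp add: field_simps of_nat_diff)
  hence "log_odds (real k / real r) = log 2 (real k) - log 2 (real (r - k))"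
    using k by (simp add: log_odds_def log_divide)
  moreover have "0 \<le> log 2 (real k)" "log 2 (real k) \<le> log 2 (real r)"
    "0 \<le> log 2 (real (r - k))" "log 2 (real (r - k)) \<le> log 2 (real r)"
    using k by auto
  ultimately show ?thesis by linarith
qed

lemma bary_log_odds_le:
  assumes "r \<ge> 1"
  shows "\<bar>log_odds (bary r s j)\<bar> \<le> log 2 (real r)"
  unfolding bary_def using assms by (intro abs_log_odds_le card_col_le)

text \<open>
  The log-odds functional is constant on \<open>S\<close> only if all column types occur equally often.
  Dividing each coefficient by the relative frequency of its type makes it exactly constant.
\<close>

lemma rescaled_functional_const:
  fixes f :: "nat \<Rightarrow> real"
  assumes bal: "balanced \<delta> d r s" and "\<delta> < 1" "d > 0" and i: "i \<in> {1..r}"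
  defines "c \<equiv> \<lambda>j. f (card (col r s j)) * ((real d / 2 ^ r) / real (col_count d r s (col r s j)))"
  shows "lin d c (s i) = (real d / 2 ^ r) * (\<Sum>A\<in>Pow {1..r}. if i \<in> A then f (card A) else 0)"
proof -
  have cube: "s i \<in> cube_vertices d" using bal i by (auto simp: balanced_def)
  define g where "g = (\<lambda>A. f (card A) * ((real d / 2 ^ r) / real (col_count d r s A)) * (if i \<in> A then 1 else 0))"
  have "lin d c (s i) = (\<Sum>j<d. g (col r s j))"
    unfolding lin_def
  proof (rule sum.cong)
    fix j
    have "Poly_Mapping.lookup (s i) j = (if i \<in> col r s j then 1 else 0)"
      using lookup_cube[OF cube, of j] i by (auto simp: col_def)
    thus "c j * Poly_Mapping.lookup (s i) j = g (col r s j)" by (simp add: c_def g_def)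
  qed simp
  also have "\<dots> = (\<Sum>A\<in>Pow {1..r}. real (col_count d r s A) * g A)" by (rule sum_col)
  also have "\<dots> = (\<Sum>A\<in>Pow {1..r}. (real d / 2 ^ r) * (if i \<in> A then f (card A) else 0))"
  proof (rule sum.cong)
    fix A assume A: "A \<in> Pow {1..r}"
    have dr: "real d / 2 ^ r > 0" using assms by simp
    have "\<bar>real (col_count d r s A) - real d / 2 ^ r\<bar> \<le> \<delta> * (real d / 2 ^ r)"
      using bal A unfolding balanced_def by blast
    moreover have "\<delta> * (real d / 2 ^ r) < 1 * (real d / 2 ^ r)"
      using dr \<open>\<delta> < 1\<close> by (intro mult_strict_right_mono)
    ultimately have "real (col_count d r s A) \<noteq> 0" by auto
    thus "real (col_count d r s A) * g A = (real d / 2 ^ r) * (if i \<in> A then f (card A) else 0)"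
      by (simp add: g_def)
  qed simp
  finally show ?thesis by (simp add: sum_distrib_left)
qed

lemma inverse_frequency_bound:
  fixes N q \<delta> :: real
  assumes "\<bar>N - q\<bar> \<le> \<delta> * q" "q > 0" "0 < \<delta>" "\<delta> \<le> 1 / 2"
  shows "\<bar>q / N - 1\<bar> \<le> 2 * \<delta>"
proof -
  have "\<delta> * q \<le> (1 / 2) * q" using assms by (intro mult_right_mono) auto
  hence N: "N \<ge> q / 2" "N > 0" using assms by linarith+
  have "\<bar>q / N - 1\<bar> = \<bar>N - q\<bar> / N" using N by (simp add: field_simps abs_if)
  also have "\<dots> \<le> (\<delta> * q) / (q / 2)" using assms N by (intro frac_le) auto
  also have "\<dots> = 2 * \<delta>" using assms by simp
  finally show ?thesis .
qed

text \<open>The bad set \<open>B\<close> depends on \<open>s\<close> alone, which later permits a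
  union bound over the independent points of \<open>X\<close>. Within the smallest cube face around
  the barycentre, a rescaled log-odds functional supports the hull; vertices off that face are
  handled by adding a large multiple of a functional that exposes it.\<close>

lemma face_if_no_bad_points:
  assumes r: "r \<ge> 2" and bal: "balanced \<delta> d r s" and \<delta>: "0 < \<delta>" "\<delta> \<le> 1 / 2" and d: "d > 0"
  obtains B where "B \<subseteq> cube_vertices d"
    "real (card B) \<le> 2 powr (real d * ((1 + \<delta>) * type_entropy r + 2 * \<delta> * log 2 (real r)))"
    "\<And>X. X \<subseteq> cube_vertices d \<Longrightarrow> X \<inter> B = {} \<Longrightarrow>
       convex hull (s ` {1..r}) face_of convex hull (X \<union> s ` {1..r})"
proof -
  let ?l = Poly_Mapping.lookup
  let ?b = "bary r s"
  \<comment> \<open>Bounds the total effect on a vertex of replacing the log-odds by the rescaled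
    coefficients \<open>c\<close>.\<close>
  define t where "t = 2 * \<delta> * log 2 (real r) * real d"
  define f where "f = (\<lambda>k. log_odds (real k / real r))"
  define q where "q = real d / 2 ^ r"
  define c where "c = (\<lambda>j. f (card (col r s j)) * (q / real (col_count d r s (col r s j))))"
  define C where "C = q * (\<Sum>A\<in>Pow {1..r}. if 1 \<in> A then f (card A) else 0)"
  define B where "B = {x \<in> cube_vertices d. in_face d ?b x \<and>
      - t \<le> (\<Sum>j<d. log_odds (?b j) * (?l x j - ?b j))}"
  have cube: "s i \<in> cube_vertices d" if "i \<in> {1..r}" for i
    using bal that by (auto simp: balanced_def)
  have b01: "0 \<le> ?b j \<and> ?b j \<le> 1" for j using bary_bounds by blast
  have cs: "lin d c (s i) = C" if i: "i \<in> {1..r}" for i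
    unfolding c_def q_def C_def
    using rescaled_functional_const[OF bal _ d i, of f] sum_Pow_containing[OF i, of 1 f] r \<delta> by simp
  have cb: "(\<Sum>j<d. c j * ?b j) = C"
    using r by (intro sum_linear_bary cube cs) auto
  have close: "\<bar>c j - log_odds (?b j)\<bar> \<le> 2 * \<delta> * log 2 (real r)" for j
  proof -
    have "\<bar>q / real (col_count d r s (col r s j)) - 1\<bar> \<le> 2 * \<delta>"
      using bal \<delta> d col_subset[of r s j] by (intro inverse_frequency_bound) (auto simp: balanced_def q_def)
    hence "\<bar>log_odds (?b j)\<bar> * \<bar>q / real (col_count d r s (col r s j)) - 1\<bar> \<le> log 2 (real r) * (2 * \<delta>)"
      using r bary_log_odds_le[of r s j] by (intro mult_mono) auto
    moreover have "c j - log_odds (?b j) = log_odds (?b j) * (q / real (col_count d r s (col r s j)) - 1)"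
      by (simp add: c_def f_def bary_def right_diff_distrib)
    ultimately show ?thesis by (simp add: abs_mult mult_ac)
  qed
  \<comment> \<open>A vertex of the face with value at least \<open>C\<close> has log-odds sum at
    least \<open>- t\<close>, hence lies in \<open>B\<close>. This applies to the points of
    \<open>s\<close> as well, so a point of \<open>X\<close> that repeats one of them counts as
    bad.\<close>
  have pos: "lin d c x < C" if x: "x \<in> cube_vertices d" "x \<notin> B" "in_face d ?b x" for x
  proof (rule ccontr)
    assume "\<not> lin d c x < C"
    hence "0 \<le> (\<Sum>j<d. c j * (?l x j - ?b j))"
      by (simp add: lin_def cb[symmetric] right_diff_distrib sum_subtractf)
    also have "\<dots> = (\<Sum>j<d. log_odds (?b j) * (?l x j - ?b j)) + (\<Sum>j<d. (c j - log_odds (?b j)) * (?l x j - ?b j))"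
      by (simp add: sum.distrib[symmetric] algebra_simps)
    also have "(\<Sum>j<d. (c j - log_odds (?b j)) * (?l x j - ?b j)) \<le> (\<Sum>j<d. 2 * \<delta> * log 2 (real r))"
    proof (rule sum_mono)
      fix j
      have "\<bar>?l x j - ?b j\<bar> \<le> 1" using lookup_cube[OF x(1), of j] b01[of j] by auto
      hence "\<bar>c j - log_odds (?b j)\<bar> * \<bar>?l x j - ?b j\<bar> \<le> 2 * \<delta> * log 2 (real r) * 1"
        using close[of j] by (intro mult_mono) auto
      thus "(c j - log_odds (?b j)) * (?l x j - ?b j) \<le> 2 * \<delta> * log 2 (real r)"
        unfolding abs_mult[symmetric] by linarith
    qed
    also have "(\<Sum>j<d. 2 * \<delta> * log 2 (real r)) = t" by (simp add: t_def)
    finally show False using x by (simp add: B_def)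
  qed
  \<comment> \<open>Larger by 1 than the most that \<open>lin d c\<close> can exceed
    \<open>C\<close> on the cube, so that a unit gap in \<open>g\<close> outweighs it.\<close>
  define M where "M = 1 + (\<Sum>j<d. \<bar>c j\<bar>)"
  \<comment> \<open>On the cube, \<open>lin d g\<close> attains its minimum \<open>\<beta>\<close>
    exactly on the smallest face around the barycentre and is at least \<open>\<beta> + 1\<close>
    elsewhere.\<close>
  define g where "g = (\<lambda>j. if ?b j = 0 then 1 else if ?b j = 1 then - 1 else (0::real))"
  define \<beta> where "\<beta> = (\<Sum>j<d. if ?b j = 1 then - 1 else (0::real))"
  have g_ge: "g j * ?l x j \<ge> (if ?b j = 1 then - 1 else 0)" if "x \<in> cube_vertices d" for x j
    using lookup_cube[OF that, of j] by (auto simp: g_def)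
  have g_face: "lin d g x = \<beta>" if "x \<in> cube_vertices d" "in_face d ?b x" for x
    unfolding lin_def \<beta>_def using that by (intro sum.cong) (auto simp: g_def in_face_def)
  have g_off: "lin d g x \<ge> \<beta> + 1" if x: "x \<in> cube_vertices d" "\<not> in_face d ?b x" for x
  proof -
    obtain k where k: "k < d" "?b k = 0 \<and> ?l x k = 1 \<or> ?b k = 1 \<and> ?l x k = 0"
      using x lookup_cube unfolding in_face_def by blast
    have "\<beta> + 1 = (\<Sum>j<d. (if ?b j = 1 then - 1 else (0::real)) + (if j = k then 1 else 0))"
      using k(1) by (simp add: \<beta>_def sum.distrib)
    also have "\<dots> \<le> lin d g x"
      unfolding lin_def
    proof (rule sum_mono)
      fix j
      show "(if ?b j = 1 then - 1 else (0::real)) + (if j = k then 1 else 0) \<le> g j * ?l x j"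
        using g_ge[OF x(1), of j] k(2) by (auto simp: g_def)
    qed
    finally show ?thesis .
  qed
  define F where "F = (\<lambda>x. M * lin d g x - lin d c x)"
  have "F = lin d (\<lambda>j. M * g j - c j)"
    by (simp add: fun_eq_iff F_def lin_def sum_distrib_left sum_subtractf left_diff_distrib mult.assoc)
  hence linF: "linear F" by (simp add: linear_lin)
  have c_le: "lin d c x - C \<le> M - 1" if x: "x \<in> cube_vertices d" for x
  proof -
    have "lin d c x - C = (\<Sum>j<d. c j * (?l x j - ?l (s 1) j))"
      using cs[of 1] r by (simp add: lin_def right_diff_distrib sum_subtractf)
    also have "\<dots> \<le> (\<Sum>j<d. \<bar>c j\<bar>)"
    proof (rule sum_mono)
      fix j
      have "\<bar>?l x j - ?l (s 1) j\<bar> \<le> 1" using lookup_cube[OF x, of j] lookup_cube[OF cube[of 1], of j] r by auto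
      hence "\<bar>c j\<bar> * \<bar>?l x j - ?l (s 1) j\<bar> \<le> \<bar>c j\<bar> * 1" by (intro mult_left_mono) auto
      thus "c j * (?l x j - ?l (s 1) j) \<le> \<bar>c j\<bar>"
        unfolding abs_mult[symmetric] by linarith
    qed
    finally show ?thesis by (simp add: M_def)
  qed
  have M: "M \<ge> 1" unfolding M_def by (simp add: sum_nonneg)
  have FS: "F y = M * \<beta> - C" if y: "y \<in> s ` {1..r}" for y
  proof -
    obtain i where i: "i \<in> {1..r}" "y = s i" using y by blast
    have "in_face d ?b (s i)" by (rule in_face_bary[OF _ i(1)]) (rule cube)
    thus ?thesis using cs[OF i(1)] g_face[OF cube[OF i(1)]] i(2) by (simp add: F_def)
  qed
  have FX: "M * \<beta> - C < F x" if x: "x \<in> cube_vertices d" "x \<notin> B" for x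
  proof (cases "in_face d ?b x")
    case True
    thus ?thesis using pos[OF x True] g_face[OF x(1) True] by (simp add: F_def)
  next
    case False
    have "M * (\<beta> + 1) \<le> M * lin d g x" using M g_off[OF x(1) False] by (intro mult_left_mono) auto
    thus ?thesis using c_le[OF x(1)] by (simp add: F_def algebra_simps)
  qed
  have "real (card B) \<le> 2 powr ((\<Sum>j<d. binary_entropy (?b j)) + t)"
    unfolding B_def by (rule card_log_odds_ge) (use b01 in auto)
  also have "\<dots> \<le> 2 powr (real d * ((1 + \<delta>) * type_entropy r + 2 * \<delta> * log 2 (real r)))"
    using entropy_balanced[OF bal] by (intro powr_mono) (auto simp: t_def algebra_simps)
  finally have "real (card B) \<le> 2 powr (real d * ((1 + \<delta>) * type_entropy r + 2 * \<delta> * log 2 (real r)))" .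
  moreover have "convex hull (s ` {1..r}) face_of convex hull (X \<union> s ` {1..r})"
    if "X \<subseteq> cube_vertices d" "X \<inter> B = {}" for X
    by (rule face_of_convex_hull_Un[OF linF FS FX]) (use that in auto)
  ultimately show ?thesis by (intro that[of B]) (auto simp: B_def)
qed

section \<open>Above the threshold\<close>

text \<open>A relative error below 1 forces every column type to occur. A coordinate with column
  \<open>{i}\<close> singles out \<open>s i\<close> among all points of \<open>s\<close>.\<close>

lemma ex_singleton_col:
  assumes bal: "balanced \<delta> d r s" and "\<delta> < 1" "d > 0" and i: "i \<in> {1..r}"
  obtains j where "j < d" "col r s j = {i}"
proof -
  have dr: "real d / 2 ^ r > 0" using assms by simp
  have "\<bar>real (col_count d r s {i}) - real d / 2 ^ r\<bar> \<le> \<delta> * (real d / 2 ^ r)"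
    using bal i unfolding balanced_def by blast
  moreover have "\<delta> * (real d / 2 ^ r) < 1 * (real d / 2 ^ r)"
    using dr \<open>\<delta> < 1\<close> by (intro mult_strict_right_mono)
  ultimately have "col_count d r s {i} \<noteq> 0" by auto
  hence "{j \<in> {..<d}. col r s j = {i}} \<noteq> {}" unfolding col_count_def by (metis card.empty)
  thus ?thesis using that by auto
qed

lemma lookup_sum_scaleR:
  "Poly_Mapping.lookup (\<Sum>v\<in>A. u v *\<^sub>R (g v :: 'a \<Rightarrow>\<^sub>0 real)) j = (\<Sum>v\<in>A. u v * Poly_Mapping.lookup (g v) j)"
  by (induction A rule: infinite_finite_induct) (simp_all add: lookup_add)

text \<open>At a coordinate with column \<open>{i}\<close>, an affine combination takes the
  coefficient of \<open>s i\<close> as its value. For a cube vertex all coefficients are therefore 0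
  or 1, and as they add up to 1, exactly one of them is 1.\<close>

lemma affine_hull_cube:
  assumes bal: "balanced \<delta> d r s" and "\<delta> < 1" "d > 0"
    and x: "x \<in> cube_vertices d" "x \<in> affine hull (s ` {1..r})"
  shows "x \<in> s ` {1..r}"
proof -
  let ?S = "s ` {1..r}"
  obtain u where u: "sum u ?S = 1" "(\<Sum>v\<in>?S. u v *\<^sub>R v) = x"
    using x(2) by (auto simp: affine_hull_finite)
  have u01: "u v = 0 \<or> u v = 1" if v: "v \<in> ?S" for v
  proof -
    obtain i where i: "i \<in> {1..r}" "v = s i" using v by auto
    obtain j where j: "j < d" "col r s j = {i}" using ex_singleton_col[OF assms(1-3) i(1)] by blast
    have "Poly_Mapping.lookup w j = (if w = v then 1 else 0)" if w: "w \<in> ?S" for w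
    proof -
      obtain k where k: "k \<in> {1..r}" "w = s k" using w by auto
      have "w \<in> cube_vertices d" using k bal by (auto simp: balanced_def)
      hence 01: "Poly_Mapping.lookup w j = 0 \<or> Poly_Mapping.lookup w j = 1" by (rule lookup_cube)
      have "Poly_Mapping.lookup (s l) j = 1 \<longleftrightarrow> l = i" if "l \<in> {1..r}" for l
        using j(2) that unfolding col_def by blast
      from this[OF k(1)] this[OF i(1)] show ?thesis using 01 i(2) k(2) by auto
    qed
    hence "Poly_Mapping.lookup x j = (\<Sum>w\<in>?S. u w * (if w = v then 1 else 0))"
      unfolding u(2)[symmetric] lookup_sum_scaleR by (intro sum.cong) auto
    also have "\<dots> = (\<Sum>w\<in>?S. if w = v then u w else 0)" by (intro sum.cong) auto
    also have "\<dots> = u v" using v by (simp add: sum.delta)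
    finally show ?thesis using lookup_cube[OF x(1), of j] by simp
  qed
  obtain v where v: "v \<in> ?S" "u v = 1"
    using u(1) u01 by (metis (mono_tags, lifting) sum.neutral zero_neq_one)
  have "sum u (?S - {v}) = 0" using u(1) v by (simp add: sum_diff1)
  hence "\<forall>w\<in>?S - {v}. u w = 0"
    using u01 by (subst (asm) sum_nonneg_eq_0_iff) (auto, force)
  hence "x = (\<Sum>w\<in>?S. if w = v then v else 0)"
    unfolding u(2)[symmetric] using v(2) by (intro sum.cong) auto
  also have "\<dots> = v" using v(1) by simp
  finally show ?thesis using v by simp
qed

definition bary_point :: "nat \<Rightarrow> (nat \<Rightarrow> nat \<Rightarrow>\<^sub>0 real) \<Rightarrow> nat \<Rightarrow>\<^sub>0 real" where
  "bary_point r s = (\<Sum>i\<in>{1..r}. (1 / real r) *\<^sub>R s i)"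

lemma lookup_bary_point:
  assumes "\<And>i. i \<in> {1..r} \<Longrightarrow> s i \<in> cube_vertices d"
  shows "Poly_Mapping.lookup (bary_point r s) j = bary r s j"
proof -
  have "bary r s j = (\<Sum>i\<in>{1..r}. Poly_Mapping.lookup (s i) j) / real r"
    by (rule bary_eq) (rule assms)
  thus ?thesis by (simp add: bary_point_def lookup_sum_scaleR sum_divide_distrib)
qed

lemma bary_point_in_hull:
  assumes "r \<ge> 1"
  shows "bary_point r s \<in> convex hull (s ` {1..r})"
  unfolding bary_point_def
  by (intro convex_sum) (use assms in \<open>auto intro: hull_inc\<close>)

lemma not_face_if_bary_point:
  assumes bal: "balanced \<delta> d r s" and "\<delta> < 1" "d > 0" "r \<ge> 1" and X: "X \<subseteq> cube_vertices d"
    and b: "bary_point r s \<in> convex hull (X - s ` {1..r})"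
  shows "\<not> (convex hull (X \<union> s ` {1..r}) \<inter> affine hull (s ` {1..r})) face_of convex hull (X \<union> s ` {1..r})"
    (is "\<not> ?G face_of ?P")
proof
  assume "?G face_of ?P"
  hence "convex (?P - ?G)" by (rule convex_Diff_face) simp
  moreover have "X - s ` {1..r} \<subseteq> ?P - ?G"
    using affine_hull_cube[OF assms(1-3)] X by (auto intro: hull_inc)
  ultimately have "bary_point r s \<in> ?P - ?G" using b hull_minimal by (metis subsetD)
  moreover have "bary_point r s \<in> ?P"
    using bary_point_in_hull[OF \<open>r \<ge> 1\<close>] hull_mono[of "s ` {1..r}" "X \<union> s ` {1..r}"] by blast
  moreover have "bary_point r s \<in> affine hull (s ` {1..r})"
    using bary_point_in_hull[OF \<open>r \<ge> 1\<close>] convex_hull_subset_affine_hull by blast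
  ultimately show False by blast
qed

text \<open>Integer normal vectors whose largest absolute value is attained at a free coordinate of
  the cube face, since the fixed ones contribute nothing on that face. The bound
  \<open>2 * r * d\<close> leaves room for rounding errors.\<close>

definition normals :: "nat \<Rightarrow> nat \<Rightarrow> (nat \<Rightarrow> nat \<Rightarrow>\<^sub>0 real) \<Rightarrow> (nat \<Rightarrow> int) set" where
  "normals d r s = {k \<in> PiE {..<d} (\<lambda>_. {- int (2 * r * d)..int (2 * r * d)}).
     \<exists>j<d. 0 < bary r s j \<and> bary r s j < 1 \<and> \<bar>k j\<bar> = int (2 * r * d)}"

definition deep_cap :: "nat \<Rightarrow> nat \<Rightarrow> (nat \<Rightarrow> nat \<Rightarrow>\<^sub>0 real) \<Rightarrow> (nat \<Rightarrow> int) \<Rightarrow> (nat \<Rightarrow>\<^sub>0 real) set" where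
  "deep_cap d r s k = {x \<in> cube_vertices d. x \<notin> s ` {1..r} \<and> in_face d (bary r s) x \<and>
     real d \<le> (\<Sum>j<d. of_int (k j) * (Poly_Mapping.lookup x j - bary r s j))}"

lemma normals_finite: "finite (normals d r s)"
  and card_normals: "card (normals d r s) \<le> (4 * r * d + 1) ^ d"
proof -
  let ?P = "PiE {..<d} (\<lambda>_. {- int (2 * r * d)..int (2 * r * d)})"
  have fin: "finite ?P" by (intro finite_PiE) auto
  have sub: "normals d r s \<subseteq> ?P" unfolding normals_def by blast
  show "finite (normals d r s)" using finite_subset[OF sub fin] .
  have "card ?P = (\<Prod>j<d. nat (4 * int r * int d + 1))" by (subst card_PiE) (auto simp: algebra_simps)
  also have "nat (4 * int r * int d + 1) = 4 * r * d + 1" by (simp add: nat_eq_iff)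
  finally show "card (normals d r s) \<le> (4 * r * d + 1) ^ d"
    using card_mono[OF fin sub] by simp
qed

text \<open>
  A separating normal vector is rounded to an integer vector; the slack \<open>d\<close> in the
  definition of \<open>deep_cap\<close> absorbs the rounding error.
\<close>

lemma bary_point_in_hull_if_hits:
  assumes bal: "balanced \<delta> d r s" and "\<delta> < 1" "d > 0" and r: "r \<ge> 2" and X: "X \<subseteq> cube_vertices d"
    and hits: "\<And>k. k \<in> normals d r s \<Longrightarrow> X \<inter> deep_cap d r s k \<noteq> {}"
  shows "bary_point r s \<in> convex hull (X - s ` {1..r})"
proof (rule ccontr)
  assume not_in: "\<not> ?thesis"
  let ?l = Poly_Mapping.lookup
  let ?b = "bary r s"
  define K where "K = 2 * r * d"
  have K: "K > 0" using r \<open>d > 0\<close> by (simp add: K_def)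
  have cube: "s i \<in> cube_vertices d" if "i \<in> {1..r}" for i
    using bal that by (auto simp: balanced_def)
  have lb: "?l (bary_point r s) j = ?b j" for j
    by (rule lookup_bary_point) (rule cube)
  have b01: "0 \<le> ?b j" "?b j \<le> 1" for j using bary_bounds by auto
  have keys: "Poly_Mapping.keys x \<subseteq> {..<d}" if "x \<in> cube_vertices d" for x
    using that by (auto simp: cube_vertices_def)
  have "Poly_Mapping.keys (bary_point r s) \<subseteq> {..<d}"
  proof (rule keys_convex_hull[OF _ bary_point_in_hull])
    show "Poly_Mapping.keys x \<subseteq> {..<d}" if "x \<in> s ` {1..r}" for x
      using that cube keys by blast
  qed (use r in simp)
  moreover have "finite X" using X finite_cube_vertices finite_subset by blast
  moreover have "Poly_Mapping.keys x \<subseteq> {..<d}" if "x \<in> X - s ` {1..r}" for x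
    using that X keys by blast
  ultimately have "\<exists>c. \<forall>x\<in>X - s ` {1..r}. lin d c x < lin d c (bary_point r s)"
    using not_in by (intro separating_functional) auto
  then obtain c where "\<forall>x\<in>X - s ` {1..r}. lin d c x < lin d c (bary_point r s)" by blast
  hence c: "(\<Sum>j<d. c j * (?l x j - ?b j)) < 0" if "x \<in> X" "x \<notin> s ` {1..r}" for x
    using that by (simp add: lin_def lb right_diff_distrib sum_subtractf)
  \<comment> \<open>The free coordinates; on the cube face every other coordinate agrees with the
    barycentre, so only \<open>c\<close> on \<open>J\<close> matters.\<close>
  define J where "J = {j \<in> {..<d}. 0 < ?b j \<and> ?b j < 1}"
  have offJ: "?l x j = ?b j" if "in_face d ?b x" "j < d" "j \<notin> J" for x j
    using that b01[of j] by (fastforce simp: J_def in_face_def)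
  obtain j1 where j1: "j1 < d" "col r s j1 = {1}" using ex_singleton_col[OF assms(1-3), of 1] r by auto
  have "j1 \<in> J" using j1 r by (simp add: J_def bary_def)
  have finJ: "finite J" by (simp add: J_def)
  define m where "m = Max ((\<lambda>j. \<bar>c j\<bar>) ` J)"
  have m_ge: "\<bar>c j\<bar> \<le> m" if "j \<in> J" for j using that finJ by (simp add: m_def)
  have "m \<in> (\<lambda>j. \<bar>c j\<bar>) ` J" unfolding m_def using finJ \<open>j1 \<in> J\<close> by (intro Max_in) auto
  then obtain j0 where j0: "j0 \<in> J" "\<bar>c j0\<bar> = m" by auto
  show False
  proof (cases "m = 0")
    \<comment> \<open>Now \<open>c\<close> vanishes on the free coordinates, so no point of the face
      can be strictly separated. Any normal vector yields such a point in \<open>X\<close>, for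
      instance the constant one.\<close>
    case True
    have "(\<lambda>j\<in>{..<d}. int K) \<in> normals d r s"
      using j1 \<open>j1 \<in> J\<close> by (auto simp: normals_def K_def J_def intro!: exI[of _ j1])
    then obtain x where x: "x \<in> X" "x \<in> deep_cap d r s (\<lambda>j\<in>{..<d}. int K)" using hits by blast
    have "(\<Sum>j<d. c j * (?l x j - ?b j)) = 0"
    proof (intro sum.neutral ballI)
      fix j assume "j \<in> {..<d}"
      thus "c j * (?l x j - ?b j) = 0"
        using m_ge[of j] True offJ[of x j] x by (cases "j \<in> J") (auto simp: deep_cap_def)
    qed
    thus False using c[OF x(1)] x(2) by (simp add: deep_cap_def)
  next
    case False
    hence m: "m > 0" using j0 by auto
    \<comment> \<open>Scaling makes the maximal coefficient exactly \<open>K\<close> or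
      \<open>- K\<close>, so rounding down leaves it intact and \<open>k\<close> is one of the
      \<open>normals\<close>.\<close>
    define k where "k = (\<lambda>j\<in>{..<d}. if j \<in> J then \<lfloor>real K * c j / m\<rfloor> else 0)"
    have ratio: "\<bar>real K * c j / m\<bar> \<le> real K" if "j \<in> J" for j
      using m_ge[OF that] m by (simp add: abs_mult divide_le_eq mult_left_mono)
    have fl: "- int K \<le> \<lfloor>real K * c j / m\<rfloor> \<and> \<lfloor>real K * c j / m\<rfloor> \<le> int K" if "j \<in> J" for j
    proof -
      have "- real K \<le> real K * c j / m" "real K * c j / m \<le> real K"
        using ratio[OF that] unfolding abs_le_iff by auto
      thus ?thesis by (auto simp: le_floor_iff floor_le_iff)
    qed
    have "real K * c j0 / m = of_int (if c j0 > 0 then int K else - int K)"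
      using j0 m by (auto simp: field_simps abs_if split: if_splits)
    hence "\<bar>k j0\<bar> = int K" using j0 by (simp add: k_def J_def del: of_int_of_nat_eq)
    moreover have "k \<in> PiE {..<d} (\<lambda>_. {- int K..int K})"
      using fl by (auto simp: k_def)
    ultimately have "k \<in> normals d r s" using j0(1)
      unfolding normals_def K_def[symmetric] J_def by blast
    then obtain x where x: "x \<in> X" "x \<in> deep_cap d r s k" using hits by blast
    have "real d \<le> (\<Sum>j<d. of_int (k j) * (?l x j - ?b j))" using x by (simp add: deep_cap_def)
    also have "\<dots> \<le> (\<Sum>j<d. real K / m * (c j * (?l x j - ?b j)) + 1)"
    proof (rule sum_mono)
      fix j assume j: "j \<in> {..<d}"
      show "of_int (k j) * (?l x j - ?b j) \<le> real K / m * (c j * (?l x j - ?b j)) + 1"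
      proof (cases "j \<in> J")
        case True
        have "\<bar>of_int (k j) - real K * c j / m\<bar> \<le> 1" using True j by (simp add: k_def) linarith
        moreover have "\<bar>?l x j - ?b j\<bar> \<le> 1"
          using lookup_cube[OF subsetD[OF X x(1)], of j] b01[of j] by auto
        ultimately have "\<bar>of_int (k j) - real K * c j / m\<bar> * \<bar>?l x j - ?b j\<bar> \<le> 1 * 1"
          by (intro mult_mono) auto
        hence "(of_int (k j) - real K * c j / m) * (?l x j - ?b j) \<le> 1"
          unfolding abs_mult[symmetric] by linarith
        thus ?thesis by (simp add: left_diff_distrib)
      next
        case False
        thus ?thesis using offJ[of x j] x j by (simp add: deep_cap_def)
      qed
    qed
    also have "\<dots> = real K / m * (\<Sum>j<d. c j * (?l x j - ?b j)) + real d"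
      by (simp add: sum.distrib sum_distrib_left)
    finally have "0 \<le> real K / m * (\<Sum>j<d. c j * (?l x j - ?b j))" by simp
    hence "0 \<le> (\<Sum>j<d. c j * (?l x j - ?b j))"
      using K m by (simp add: zero_le_mult_iff divide_less_0_iff zero_le_divide_iff)
    thus False using c[OF x(1)] x(2) by (simp add: deep_cap_def)
  qed
qed

text \<open>Only the factor at \<open>k\<close> changes; the new one is at most 1, and
  \<open>R\<close> times the old one is at least 1.\<close>

lemma bernoulli_weight_update_le:
  assumes b: "\<And>j. j < d \<Longrightarrow> 0 \<le> b j \<and> b j \<le> 1" and k: "k < d" and v: "v = 0 \<or> v = 1"
    and R: "1 \<le> R * b k" "1 \<le> R * (1 - b k)" "0 \<le> R" and x: "x \<in> cube_vertices d"
  shows "bernoulli_weight d (b(k := v)) x \<le> R * bernoulli_weight d b x"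
proof -
  let ?f = "\<lambda>b j. if Poly_Mapping.lookup x j = 1 then b j else 1 - b j :: real"
  have rem: "bernoulli_weight d b x = ?f b k * (\<Prod>j\<in>{..<d} - {k}. ?f b j)" for b
    unfolding bernoulli_weight_def using k by (subst prod.remove[of _ k]) auto
  have "(\<Prod>j\<in>{..<d} - {k}. ?f (b(k := v)) j) = (\<Prod>j\<in>{..<d} - {k}. ?f b j)"
    by (intro prod.cong) auto
  hence "bernoulli_weight d (b(k := v)) x = ?f (b(k := v)) k * (\<Prod>j\<in>{..<d} - {k}. ?f b j)"
    by (simp only: rem)
  also have "\<dots> \<le> (R * ?f b k) * (\<Prod>j\<in>{..<d} - {k}. ?f b j)"
    using R v b by (intro mult_right_mono prod_nonneg) auto
  also have "\<dots> = R * bernoulli_weight d b x" by (simp only: rem mult.assoc)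
  finally show ?thesis .
qed

text \<open>
  Fixing the coordinate \<open>j0\<close> with \<open>\<bar>k j0\<bar> = 2 * r * d\<close> to its favourable value changes the Bernoulli weight
  by a factor of at most \<open>r\<close>, but moves the mean of \<open>Y\<close> up to \<open>2 * d\<close>. Since \<open>Y \<le> 2 * r * d\<^sup>2\<close>,
  a first moment bound then suffices for \<open>Y \<ge> d\<close> to have weight of order \<open>1 / d\<close>, which
  exceeds the exponentially small weight of atypical points.
\<close>

lemma card_deep_cap:
  assumes bal: "balanced \<delta> d r s" and \<delta>: "0 < \<delta>" "\<delta> < 1" and d: "d > 0" and r: "r \<ge> 2"
    and k: "k \<in> normals d r s"
  shows "1 / (2 * (real r)\<^sup>2 * real d) \<le>
    (real (card (deep_cap d r s k)) + real r) * 2 powr (\<delta> * real d - (1 - \<delta>) * type_entropy r * real d)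
     + exp (- (\<delta>\<^sup>2 / (4 * (log 2 (real r))\<^sup>2)) * real d)"
proof -
  let ?l = Poly_Mapping.lookup
  let ?b = "bary r s"
  let ?W = "bernoulli_weight d ?b"
  let ?U = "deep_cap d r s k"
  define K where "K = 2 * r * d"
  define Y where "Y = (\<lambda>x. \<Sum>j<d. of_int (k j) * (?l x j - ?b j))"
  define Z where "Z = (\<lambda>x. \<Sum>j<d. log_odds (?b j) * (?l x j - ?b j))"
  define H where "H = (\<Sum>j<d. binary_entropy (?b j))"
  have b01: "0 \<le> ?b j" "?b j \<le> 1" for j using bary_bounds by auto
  obtain j0 where j0: "j0 < d" "0 < ?b j0" "?b j0 < 1" "\<bar>k j0\<bar> = int K"
    using k unfolding normals_def K_def by blast
  have kK: "\<bar>k j\<bar> \<le> int K" if "j < d" for j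
    using k that unfolding normals_def K_def by (fastforce simp: abs_le_iff dest: PiE_mem)
  have K: "K > 0" using d r by (simp add: K_def)
  have c0: "0 < card (col r s j0)" "card (col r s j0) < r"
    using j0 r by (simp_all add: bary_def zero_less_divide_iff)
  \<comment> \<open>A fractional barycentre coordinate is a multiple of \<open>1 / r\<close>, so it
    keeps distance at least \<open>1 / r\<close> from 0 and 1.\<close>
  have R: "1 \<le> real r * ?b j0" "1 \<le> real r * (1 - ?b j0)"
    using c0 r by (auto simp: bary_def right_diff_distrib)
  define v where "v = (if k j0 > 0 then 1 else 0 :: real)"
  define W' where "W' = bernoulli_weight d (?b(j0 := v))"
  have W'_nn: "0 \<le> W' x" for x
    unfolding W'_def by (rule bernoulli_weight_nonneg) (use b01 in \<open>auto simp: v_def\<close>)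
  have W_nn: "0 \<le> ?W x" for x
    by (rule bernoulli_weight_nonneg) (use b01 in auto)
  have W'_le: "W' x \<le> real r * ?W x" if "x \<in> cube_vertices d" for x
    unfolding W'_def using b01 j0(1) R that
    by (intro bernoulli_weight_update_le) (auto simp: v_def)
  define A where "A = {x \<in> cube_vertices d. real d \<le> Y x}"
  have finA: "finite A" by (simp add: A_def finite_cube_vertices)
  have "real K \<le> real r * (of_int (k j0) * (v - ?b j0))"
  proof (cases "k j0 > 0")
    case True
    hence "real_of_int (k j0) = real K" using j0(4) by simp
    thus ?thesis using R(2) mult_left_mono[of 1 "real r * (1 - ?b j0)" "real K"] True
      by (simp add: v_def mult_ac)
  next
    case False
    hence "real_of_int (k j0) = - real K" using j0(4) by linarith
    thus ?thesis using R(1) mult_left_mono[of 1 "real r * ?b j0" "real K"] False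
      by (simp add: v_def mult_ac)
  qed
  also have "of_int (k j0) * (v - ?b j0) = (\<Sum>j<d. of_int (k j) * ((?b(j0 := v)) j - ?b j))"
    using j0(1) by (subst sum.remove[of _ j0]) auto
  also have "\<dots> = (\<Sum>x\<in>cube_vertices d. W' x * Y x)"
    unfolding W'_def Y_def by (rule sum_bernoulli_weight_linear[symmetric])
  also have "\<dots> \<le> (\<Sum>x\<in>cube_vertices d. W' x * real d + (if x \<in> A then W' x * (real K * real d) else 0))"
  proof (rule sum_mono)
    fix x assume x: "x \<in> cube_vertices d"
    have "Y x \<le> (\<Sum>j<d. real K)"
      unfolding Y_def
    proof (rule sum_mono)
      fix j assume j: "j \<in> {..<d}"
      have "\<bar>of_int (k j)\<bar> \<le> real K" using kK[of j] j by simp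
      moreover have "\<bar>?l x j - ?b j\<bar> \<le> 1" using lookup_cube[OF x, of j] b01[of j] by auto
      ultimately have "\<bar>of_int (k j)\<bar> * \<bar>?l x j - ?b j\<bar> \<le> real K * 1" by (intro mult_mono) auto
      thus "of_int (k j) * (?l x j - ?b j) \<le> real K" unfolding abs_mult[symmetric] by linarith
    qed
    hence "Y x \<le> real d + (if x \<in> A then real K * real d else 0)"
      using x by (auto simp: A_def mult.commute)
    hence "W' x * Y x \<le> W' x * (real d + (if x \<in> A then real K * real d else 0))"
      using W'_nn by (rule mult_left_mono)
    thus "W' x * Y x \<le> W' x * real d + (if x \<in> A then W' x * (real K * real d) else 0)"
      by (simp add: distrib_left split: if_splits)
  qed
  also have "\<dots> = real d + real K * real d * (\<Sum>x\<in>A. W' x)"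
  proof -
    have "(\<Sum>x\<in>cube_vertices d. if x \<in> A then W' x * (real K * real d) else 0) = (\<Sum>x\<in>A. W' x * (real K * real d))"
      by (subst sum.inter_restrict[symmetric]) (auto simp: finite_cube_vertices A_def intro: sum.cong)
    moreover have "(\<Sum>x\<in>cube_vertices d. W' x * real d) = real d"
      unfolding sum_distrib_right[symmetric] W'_def by (simp add: sum_bernoulli_weight)
    ultimately show ?thesis by (simp add: sum.distrib sum_distrib_left mult_ac)
  qed
  finally have "real K \<le> real r * (real d + real K * real d * (\<Sum>x\<in>A. W' x))"
    using r by simp
  hence "2 * real r * real d \<le> real r * real d * (1 + 2 * real r * real d * (\<Sum>x\<in>A. W' x))"
    by (simp add: K_def algebra_simps)
  hence "2 \<le> 1 + 2 * real r * real d * (\<Sum>x\<in>A. W' x)"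
    using r d by simp
  hence "1 / (2 * real r * real d) \<le> (\<Sum>x\<in>A. W' x)"
    using r d by (simp add: field_simps)
  also have "\<dots> \<le> (\<Sum>x\<in>A. real r * ?W x)"
    by (intro sum_mono W'_le) (auto simp: A_def)
  finally have 1: "1 / (2 * (real r)\<^sup>2 * real d) \<le> (\<Sum>x\<in>A. ?W x)"
    using r d unfolding sum_distrib_left[symmetric] by (simp add: field_simps power2_eq_square)
  define T where "T = {x \<in> cube_vertices d. \<delta> * real d \<le> Z x}"
  \<comment> \<open>The typical part of \<open>A\<close>: each of its points has weight at most
    \<open>2 powr (\<delta> * d - H)\<close>, so a lower bound on the weight of \<open>V\<close>
    becomes one on its cardinality. The atypical set \<open>T\<close> is controlled by the Chernoff
    bound.\<close>
  define V where "V = {x \<in> A. in_face d ?b x \<and> Z x < \<delta> * real d}"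
  have finTV: "finite T" "finite V" using finA by (auto simp: T_def V_def finite_cube_vertices)
  have "(\<Sum>x\<in>A. ?W x) = (\<Sum>x\<in>{x \<in> A. in_face d ?b x}. ?W x)"
    using finA by (intro sum.mono_neutral_right) (auto simp: A_def bernoulli_weight_eq_0)
  also have "\<dots> \<le> (\<Sum>x\<in>V \<union> T. ?W x)"
    using finTV W_nn by (intro sum_mono2) (auto simp: T_def V_def A_def)
  also have "\<dots> = (\<Sum>x\<in>V. ?W x) + (\<Sum>x\<in>T. ?W x)"
    using finTV by (intro sum.union_disjoint) (auto simp: T_def V_def)
  also have "(\<Sum>x\<in>T. ?W x) \<le> exp (- (\<delta>\<^sup>2 / (4 * (log 2 (real r))\<^sup>2)) * real d)"
  proof -
    have "1 \<le> log 2 (real r)" using r by simp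
    hence "\<delta> \<le> 2 * log 2 (real r)" using \<delta> by linarith
    thus ?thesis unfolding T_def Z_def
      using \<delta> b01 r bary_log_odds_le[of r s] by (intro bernoulli_weight_chernoff) auto
  qed
  also have "(\<Sum>x\<in>V. ?W x) \<le> (\<Sum>x\<in>V. 2 powr (\<delta> * real d - H))"
  proof (rule sum_mono)
    fix x assume x: "x \<in> V"
    have "?W x = 2 powr (Z x - H)"
      unfolding Z_def H_def using x b01 by (intro bernoulli_weight_eq) (auto simp: V_def A_def)
    thus "?W x \<le> 2 powr (\<delta> * real d - H)" using x by (simp add: V_def)
  qed
  also have "\<dots> = real (card V) * 2 powr (\<delta> * real d - H)" by simp
  also have "\<dots> \<le> (real (card ?U) + real r) * 2 powr (\<delta> * real d - (1 - \<delta>) * type_entropy r * real d)"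
  proof (intro mult_mono powr_mono)
    \<comment> \<open>The summand \<open>r\<close> pays for the points of \<open>s\<close>, which
      the deep cap omits.\<close>
    have "V \<subseteq> ?U \<union> s ` {1..r}" by (auto simp: V_def A_def Y_def deep_cap_def)
    moreover have "finite ?U" by (simp add: deep_cap_def finite_cube_vertices)
    ultimately have "card V \<le> card (?U \<union> s ` {1..r})" by (intro card_mono) auto
    also have "\<dots> \<le> card ?U + card (s ` {1..r})" by (rule card_Un_le)
    also have "card (s ` {1..r}) \<le> r" using card_image_le[of "{1..r}" s] by simp
    finally show "real (card V) \<le> real (card ?U) + real r" by simp
    show "\<delta> * real d - H \<le> \<delta> * real d - (1 - \<delta>) * type_entropy r * real d"
      using entropy_balanced[OF bal] by (simp add: H_def abs_le_iff algebra_simps)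
  qed auto
  finally show ?thesis using 1 by linarith
qed

section \<open>Random points\<close>

text \<open>Conditioning on the first component: outside \<open>G\<close> the conditional
  probability is bounded by 1, inside by \<open>\<beta>\<close>.\<close>

lemma prob_pair_pmf_le:
  assumes "\<And>s. s \<in> set_pmf A \<Longrightarrow> s \<in> G \<Longrightarrow> measure_pmf.prob B {x. (s, x) \<in> E} \<le> \<beta>" "\<beta> \<ge> 0"
  shows "measure_pmf.prob (pair_pmf A B) E \<le> measure_pmf.prob A (- G) + \<beta>"
proof -
  have "emeasure (pair_pmf A B) E = (\<integral>\<^sup>+s. \<integral>\<^sup>+x. indicator E (s, x) \<partial>B \<partial>A)"
    by (subst nn_integral_pair_pmf'[symmetric]) simp
  also have "\<dots> = (\<integral>\<^sup>+s. ennreal (measure_pmf.prob B {x. (s, x) \<in> E}) \<partial>A)"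
  proof (rule nn_integral_cong)
    fix s
    have "(\<integral>\<^sup>+x. indicator E (s, x) \<partial>B) = (\<integral>\<^sup>+x. indicator {x. (s, x) \<in> E} x \<partial>B)"
      by (intro nn_integral_cong) (simp add: indicator_def)
    thus "(\<integral>\<^sup>+x. indicator E (s, x) \<partial>B) = ennreal (measure_pmf.prob B {x. (s, x) \<in> E})"
      by (simp add: measure_pmf.emeasure_eq_measure)
  qed
  also have "\<dots> \<le> (\<integral>\<^sup>+s. indicator (- G) s + ennreal \<beta> \<partial>A)"
  proof (intro nn_integral_mono_AE AE_pmfI)
    fix s assume "s \<in> set_pmf A"
    thus "ennreal (measure_pmf.prob B {x. (s, x) \<in> E}) \<le> indicator (- G) s + ennreal \<beta>"
      using assms(1)[of s] assms(2) measure_pmf.prob_le_1[of B "{x. (s, x) \<in> E}"]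
      by (cases "s \<in> G") (auto simp: ennreal_leI add_increasing2 simp flip: ennreal_1 ennreal_plus)
  qed
  also have "\<dots> = ennreal (measure_pmf.prob A (- G) + \<beta>)"
    using assms(2) by (subst nn_integral_add) (auto simp: measure_pmf.emeasure_eq_measure measure_pmf.emeasure_space_1)
  finally have "ennreal (measure_pmf.prob (pair_pmf A B) E) \<le> ennreal (measure_pmf.prob A (- G) + \<beta>)"
    by (simp only: measure_pmf.emeasure_eq_measure)
  thus ?thesis using assms(2) by (subst (asm) ennreal_le_iff) auto
qed

section \<open>Hitting and missing a set of cube vertices\<close>

lemma set_random_vertices:
  "set_pmf (random_vertices d k) = PiE_dflt {1..k} 0 (\<lambda>_. cube_vertices d)"
  unfolding random_vertices_def
  by (subst set_Pi_pmf) (simp_all add: finite_cube_vertices cube_vertices_nonempty o_def)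

lemma random_vertices_in_cube:
  "x \<in> set_pmf (random_vertices d k) \<Longrightarrow> x ` {1..k} \<subseteq> cube_vertices d"
  by (auto simp: set_random_vertices PiE_dflt_def)

lemma finite_set_random_vertices: "finite (set_pmf (random_vertices d k))"
  unfolding set_random_vertices by (intro finite_PiE_dflt) (auto simp: finite_cube_vertices)

lemma prob_cube: "measure_pmf.prob (pmf_of_set (cube_vertices d)) B = real (card (cube_vertices d \<inter> B)) / 2 ^ d"
  by (simp add: measure_pmf_of_set cube_vertices_nonempty finite_cube_vertices card_cube_vertices)

lemma prob_hit_le:
  assumes "B \<subseteq> cube_vertices d"
  shows "measure_pmf.prob (random_vertices d m) {x. x ` {1..m} \<inter> B \<noteq> {}} \<le> real m * real (card B) / 2 ^ d"
proof -
  have "{x. x ` {1..m} \<inter> B \<noteq> {}} = (\<Union>k\<in>{1..m}. {x. x k \<in> B})" by auto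
  hence "measure_pmf.prob (random_vertices d m) {x. x ` {1..m} \<inter> B \<noteq> {}} \<le>
      (\<Sum>k\<in>{1..m}. measure_pmf.prob (random_vertices d m) {x. x k \<in> B})"
    by (simp add: measure_UNION_le)
  also have "\<dots> = (\<Sum>k\<in>{1..m}. real (card B) / 2 ^ d)"
  proof (rule sum.cong)
    fix k assume k: "k \<in> {1..m}"
    have "measure_pmf.prob (random_vertices d m) {x. x k \<in> B} =
        measure_pmf.prob (map_pmf (\<lambda>f. f k) (random_vertices d m)) B"
      by (simp add: vimage_def)
    also have "map_pmf (\<lambda>f. f k) (random_vertices d m) = pmf_of_set (cube_vertices d)"
      unfolding random_vertices_def using k by (subst Pi_pmf_component) auto
    finally show "measure_pmf.prob (random_vertices d m) {x. x k \<in> B} = real (card B) / 2 ^ d"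
      using assms by (simp add: prob_cube Int_absorb1)
  qed simp
  finally show ?thesis by simp
qed

text \<open>By independence the probability is a power of \<open>1 - p\<close>, where
  \<open>p\<close> is the density of \<open>U\<close>, and
  \<open>1 - p \<le> exp (- p)\<close>.\<close>

lemma prob_miss_le:
  assumes "U \<subseteq> cube_vertices d"
  shows "measure_pmf.prob (random_vertices d m) {x. x ` {1..m} \<inter> U = {}} \<le> exp (- (real m * real (card U) / 2 ^ d))"
proof -
  let ?p = "real (card U) / 2 ^ d"
  have "{x. x ` {1..m} \<inter> U = {}} = Pi {1..m} (\<lambda>_. - U)" by auto
  hence "measure_pmf.prob (random_vertices d m) {x. x ` {1..m} \<inter> U = {}} =
      (\<Prod>k\<in>{1..m}. measure_pmf.prob (pmf_of_set (cube_vertices d)) (- U))"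
    unfolding random_vertices_def by (simp only: measure_Pi_pmf_Pi finite_atLeastAtMost)
  also have "measure_pmf.prob (pmf_of_set (cube_vertices d)) (- U) = 1 - ?p"
    using assms measure_pmf.prob_compl[of U "pmf_of_set (cube_vertices d)"]
    by (simp add: prob_cube Int_absorb1 Compl_eq_Diff_UNIV)
  finally have "measure_pmf.prob (random_vertices d m) {x. x ` {1..m} \<inter> U = {}} = (1 - ?p) ^ m"
    by simp
  also have "\<dots> \<le> exp (- ?p) ^ m"
  proof (rule power_mono)
    show "1 - ?p \<le> exp (- ?p)" using exp_ge_add_one_self[of "- ?p"] by simp
    have "card U \<le> 2 ^ d" using card_mono[OF finite_cube_vertices assms] by (simp add: card_cube_vertices)
    hence "real (card U) \<le> 2 ^ d" by (metis of_nat_le_iff of_nat_numeral of_nat_power)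
    thus "0 \<le> 1 - ?p" by simp
  qed
  also have "\<dots> = exp (- (real m * real (card U) / 2 ^ d))"
    by (simp add: exp_of_nat_mult[symmetric])
  finally show ?thesis .
qed

section \<open>Concentration of the column counts\<close>

lemma prob_cube_fixed_coords:
  assumes J: "J \<subseteq> {..<d}"
  shows "measure_pmf.prob (pmf_of_set (cube_vertices d)) {x. \<forall>j\<in>J. (Poly_Mapping.lookup x j = 1) = a} = 1 / 2 ^ card J"
proof -
  let ?B = "{x. \<forall>j\<in>J. (Poly_Mapping.lookup x j = 1) = a}"
  have "real (card (cube_vertices d \<inter> ?B)) = (\<Sum>x\<in>cube_vertices d. if x \<in> ?B then 1 else 0)"
    by (simp add: sum.If_cases finite_cube_vertices)
  \<comment> \<open>The indicator is a product over the coordinates, so the count factorises: 1 for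
    each prescribed coordinate, 2 for each free one.\<close>
  also have "\<dots> = (\<Sum>x\<in>cube_vertices d. \<Prod>j<d. if j \<in> J \<longrightarrow> (Poly_Mapping.lookup x j = 1) = a then 1 else 0)"
  proof (rule sum.cong)
    fix x
    show "(if x \<in> ?B then 1 else 0) = (\<Prod>j<d. if j \<in> J \<longrightarrow> (Poly_Mapping.lookup x j = 1) = a then 1 else (0::real))"
    proof (cases "x \<in> ?B")
      case False
      then obtain j where "j \<in> J" "(Poly_Mapping.lookup x j = 1) \<noteq> a" by blast
      hence "(\<Prod>j<d. if j \<in> J \<longrightarrow> (Poly_Mapping.lookup x j = 1) = a then 1 else (0::real)) = 0"
        using J by (intro prod_zero bexI[of _ j]) auto
      thus ?thesis using False by simp
    qed (auto intro!: prod.neutral[symmetric])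
  qed simp
  also have "\<dots> = (\<Prod>j<d. (if j \<in> J \<longrightarrow> ((0::real) = 1) = a then 1 else 0) + (if j \<in> J \<longrightarrow> ((1::real) = 1) = a then 1 else 0))"
    by (rule sum_cube_prod[of "\<lambda>j t. if j \<in> J \<longrightarrow> (t = 1) = a then 1 else 0" d])
  also have "\<dots> = (\<Prod>j<d. if j \<in> J then 1 else 2)" by (intro prod.cong) auto
  also have "\<dots> = 2 ^ card ({..<d} - J)"
    by (simp add: prod.If_cases Diff_eq)
  also have "card ({..<d} - J) = d - card J" using J by (simp add: card_Diff_subset finite_subset)
  finally have "real (card (cube_vertices d \<inter> ?B)) = 2 ^ (d - card J)" .
  moreover have "card J \<le> d" using card_mono[OF _ J] by simp
  ultimately show ?thesis by (simp add: prob_cube power_diff)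
qed

text \<open>The event prescribes the coordinates in \<open>J\<close> for each row separately, and
  the rows are independent. With one- and two-element \<open>J\<close> this yields pairwise
  independence of the columns.\<close>

lemma prob_cols:
  assumes J: "J \<subseteq> {..<d}" and A: "A \<subseteq> {1..r}"
  shows "measure_pmf.prob (random_vertices d r) {s. \<forall>j\<in>J. col r s j = A} = (1 / 2 ^ r) ^ card J"
proof -
  have "{s. \<forall>j\<in>J. col r s j = A} = Pi {1..r} (\<lambda>i. {x. \<forall>j\<in>J. (Poly_Mapping.lookup x j = 1) = (i \<in> A)})"
    using A by (auto simp: col_def Pi_def set_eq_iff)
  hence "measure_pmf.prob (random_vertices d r) {s. \<forall>j\<in>J. col r s j = A} = (\<Prod>i\<in>{1..r}. 1 / 2 ^ card J)"
    unfolding random_vertices_def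
    by (simp only: measure_Pi_pmf_Pi finite_atLeastAtMost prob_cube_fixed_coords[OF J])
  thus ?thesis by (simp add: power_divide power_mult[symmetric] mult.commute)
qed

lemma integrable_random_vertices [simp]:
  "integrable (measure_pmf (random_vertices d r)) (f :: _ \<Rightarrow> real)"
  by (rule integrable_measure_pmf_finite[OF finite_set_random_vertices])

lemma variance_col_count:
  assumes A: "A \<subseteq> {1..r}"
  shows "measure_pmf.expectation (random_vertices d r) (\<lambda>s. (real (col_count d r s A) - real d / 2 ^ r)\<^sup>2) \<le> real d"
proof -
  let ?q = "1 / 2 ^ r :: real"
  let ?E = "measure_pmf.expectation (random_vertices d r)"
  define I where "I = (\<lambda>j s. if col r s j = A then 1 else 0 :: real)"
  have EI: "?E (\<lambda>s. I j s) = ?q" if "j < d" for j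
  proof -
    have "?E (\<lambda>s. I j s) = ?E (indicator {s. \<forall>j\<in>{j}. col r s j = A})"
      by (intro Bochner_Integration.integral_cong) (auto simp: I_def indicator_def)
    thus ?thesis using prob_cols[OF _ A, of "{j}" d] that by simp
  qed
  have EII: "?E (\<lambda>s. I j s * I k s) = (if j = k then ?q else ?q\<^sup>2)" if "j < d" "k < d" for j k
  proof -
    have "?E (\<lambda>s. I j s * I k s) = ?E (indicator {s. \<forall>l\<in>{j, k}. col r s l = A})"
      by (intro Bochner_Integration.integral_cong) (auto simp: I_def indicator_def)
    thus ?thesis using prob_cols[OF _ A, of "{j, k}" d] that by (auto simp: card_insert_if power2_eq_square)
  qed
  have count: "real (col_count d r s A) = (\<Sum>j<d. I j s)" for s
    by (simp add: I_def col_count_def sum.If_cases Int_def)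
  have "?E (\<lambda>s. (real (col_count d r s A) - real d / 2 ^ r)\<^sup>2) =
      ?E (\<lambda>s. \<Sum>j<d. \<Sum>k<d. I j s * I k s - ?q * I j s - ?q * I k s + ?q\<^sup>2)"
  proof (rule Bochner_Integration.integral_cong)
    fix s
    have "real (col_count d r s A) - real d / 2 ^ r = (\<Sum>j<d. I j s - ?q)"
      by (simp add: count sum_subtractf)
    thus "(real (col_count d r s A) - real d / 2 ^ r)\<^sup>2 =
        (\<Sum>j<d. \<Sum>k<d. I j s * I k s - ?q * I j s - ?q * I k s + ?q\<^sup>2)"
      by (simp add: power2_eq_square sum_product algebra_simps)
  qed simp
  also have "\<dots> = (\<Sum>j<d. \<Sum>k<d. ?E (\<lambda>s. I j s * I k s) - ?q * ?E (I j) - ?q * ?E (I k) + ?q\<^sup>2)"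
    by simp
  \<comment> \<open>The covariances of distinct columns vanish.\<close>
  also have "\<dots> = (\<Sum>j<d. \<Sum>k<d. if j = k then ?q - ?q\<^sup>2 else 0)"
    by (intro sum.cong refl) (auto simp: EI EII power2_eq_square)
  also have "\<dots> = (\<Sum>j<d. ?q - ?q\<^sup>2)" by (intro sum.cong refl) (simp add: sum.delta)
  also have "\<dots> \<le> (\<Sum>j<d. 1)" 
  proof (intro sum_mono)
    have "?q \<le> 1" by simp
    thus "?q - ?q\<^sup>2 \<le> 1" by (smt (verit) zero_le_power2)
  qed
  finally show ?thesis by simp
qed

text \<open>Chebyshev's inequality for each of the \<open>2 ^ r\<close> column types, followed by a
  union bound.\<close>

lemma prob_not_balanced:
  assumes \<delta>: "\<delta> > 0" and d: "d > 0"
  shows "measure_pmf.prob (random_vertices d r) (- {s. balanced \<delta> d r s}) \<le> 8 ^ r / (\<delta>\<^sup>2 * real d)"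
proof -
  let ?M = "random_vertices d r"
  let ?a = "\<delta> * (real d / 2 ^ r)"
  define D where "D = (\<lambda>A. {s. ?a \<le> \<bar>real (col_count d r s A) - real d / 2 ^ r\<bar>})"
  have a: "?a > 0" using assms by simp
  have D_le: "measure_pmf.prob ?M (D A) \<le> real d / ?a\<^sup>2" if A: "A \<in> Pow {1..r}" for A
  proof -
    let ?f = "\<lambda>s. (real (col_count d r s A) - real d / 2 ^ r)\<^sup>2"
    have "?a\<^sup>2 * measure_pmf.prob ?M (D A) = measure_pmf.expectation ?M (\<lambda>s. ?a\<^sup>2 * indicator (D A) s)"
      by simp
    also have "\<dots> \<le> measure_pmf.expectation ?M ?f"
    proof (rule integral_mono)
      fix s
      show "?a\<^sup>2 * indicator (D A) s \<le> ?f s"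
      proof (cases "s \<in> D A")
        case True
        hence "?a \<le> \<bar>real (col_count d r s A) - real d / 2 ^ r\<bar>" by (simp add: D_def)
        hence "?a\<^sup>2 \<le> \<bar>real (col_count d r s A) - real d / 2 ^ r\<bar>\<^sup>2"
          using a by (intro power_mono) auto
        thus ?thesis using True by simp
      qed simp
    qed simp_all
    also have "\<dots> \<le> real d" using A by (intro variance_col_count) auto
    finally show ?thesis
      by (simp only: pos_le_divide_eq[OF zero_less_power[OF a]] mult.commute)
  qed
  have "measure_pmf.prob ?M (- {s. balanced \<delta> d r s}) = measure_pmf.prob ?M (- {s. balanced \<delta> d r s} \<inter> set_pmf ?M)"
    by (simp only: measure_Int_set_pmf)
  also have "\<dots> \<le> measure_pmf.prob ?M (\<Union>A\<in>Pow {1..r}. D A)"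
  proof (rule measure_pmf.finite_measure_mono)
    show "- {s. balanced \<delta> d r s} \<inter> set_pmf ?M \<subseteq> (\<Union>A\<in>Pow {1..r}. D A)"
    proof
      fix s assume "s \<in> - {s. balanced \<delta> d r s} \<inter> set_pmf ?M"
      hence "\<not> balanced \<delta> d r s" "\<forall>i\<in>{1..r}. s i \<in> cube_vertices d"
        using random_vertices_in_cube by blast+
      then obtain A where "A \<in> Pow {1..r}" "\<not> \<bar>real (col_count d r s A) - real d / 2 ^ r\<bar> \<le> ?a"
        unfolding balanced_def by blast
      thus "s \<in> (\<Union>A\<in>Pow {1..r}. D A)" by (intro UN_I[of A]) (auto simp: D_def)
    qed
  qed simp
  also have "\<dots> \<le> (\<Sum>A\<in>Pow {1..r}. measure_pmf.prob ?M (D A))"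
    by (intro measure_UNION_le) auto
  also have "\<dots> \<le> (\<Sum>A\<in>Pow {1..r}. real d / ?a\<^sup>2)" by (intro sum_mono D_le)
  also have "\<dots> = 2 ^ r * (real d / ?a\<^sup>2)" by (simp add: card_Pow)
  also have "\<dots> = 8 ^ r / (\<delta>\<^sup>2 * real d)"
  proof -
    have "(8::real) ^ r = 2 ^ r * (2 ^ r)\<^sup>2"
      by (simp add: power2_eq_square flip: power_mult_distrib)
    thus ?thesis using assms by (simp add: power_mult_distrib power_divide power2_eq_square)
  qed
  finally show ?thesis .
qed

section \<open>Probability bounds and limits\<close>

text \<open>Given balanced \<open>s\<close>, the face property can fail only if some point of
  \<open>x\<close> hits the bad set, whose density is small below the threshold.\<close>

lemma prob_not_face_le:
  fixes m d r :: nat and \<delta> :: real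
  assumes r: "r \<ge> 2" and \<delta>: "0 < \<delta>" "\<delta> \<le> 1 / 2" and d: "d > 0"
  shows "measure_pmf.prob (random_points d r m)
      {(s, x). \<not> convex hull (s ` {1..r}) face_of convex hull (x ` {1..m} \<union> s ` {1..r})}
    \<le> 8 ^ r / (\<delta>\<^sup>2 * real d) +
      real m * 2 powr (real d * ((1 + \<delta>) * type_entropy r + 2 * \<delta> * log 2 (real r))) / 2 ^ d"
    (is "measure_pmf.prob _ ?E \<le> _ + ?\<beta>")
proof -
  have "measure_pmf.prob (random_points d r m) ?E \<le>
      measure_pmf.prob (random_vertices d r) (- {s. balanced \<delta> d r s}) + ?\<beta>"
    unfolding random_points_def
  proof (rule prob_pair_pmf_le)
    fix s assume "s \<in> {s. balanced \<delta> d r s}"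
    hence bal: "balanced \<delta> d r s" by simp
    from face_if_no_bad_points[OF r bal \<delta> d] obtain B where B: "B \<subseteq> cube_vertices d"
      "real (card B) \<le> 2 powr (real d * ((1 + \<delta>) * type_entropy r + 2 * \<delta> * log 2 (real r)))"
      "\<And>X. X \<subseteq> cube_vertices d \<Longrightarrow> X \<inter> B = {} \<Longrightarrow>
         convex hull (s ` {1..r}) face_of convex hull (X \<union> s ` {1..r})" by blast
    let ?M = "random_vertices d m"
    have "measure_pmf.prob ?M {x. (s, x) \<in> ?E} = measure_pmf.prob ?M ({x. (s, x) \<in> ?E} \<inter> set_pmf ?M)"
      by (simp only: measure_Int_set_pmf)
    also have "\<dots> \<le> measure_pmf.prob ?M {x. x ` {1..m} \<inter> B \<noteq> {}}"
    proof (rule measure_pmf.finite_measure_mono)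
      show "{x. (s, x) \<in> ?E} \<inter> set_pmf ?M \<subseteq> {x. x ` {1..m} \<inter> B \<noteq> {}}"
      proof
        fix x assume x: "x \<in> {x. (s, x) \<in> ?E} \<inter> set_pmf ?M"
        hence "x ` {1..m} \<subseteq> cube_vertices d" by (intro random_vertices_in_cube) simp
        from B(3)[OF this] show "x \<in> {x. x ` {1..m} \<inter> B \<noteq> {}}" using x by auto
      qed
    qed simp
    also have "\<dots> \<le> real m * real (card B) / 2 ^ d" by (rule prob_hit_le) (rule B(1))
    also have "\<dots> \<le> ?\<beta>" using B(2) by (intro divide_right_mono mult_left_mono) auto
    finally show "measure_pmf.prob ?M {x. (s, x) \<in> ?E} \<le> ?\<beta>" .
  qed simp
  thus ?thesis using prob_not_balanced[OF \<delta>(1) d, of r] by linarith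
qed

text \<open>The assumption on \<open>u\<close> makes it a lower bound for the size of every deep
  cap. Given balanced \<open>s\<close>, the intersection can be a face only if \<open>x\<close>
  misses one of the caps, and there are at most \<open>(4 * r * d + 1) ^ d\<close> of them.\<close>

lemma prob_face_le:
  fixes m d r :: nat and \<delta> u :: real
  assumes r: "r \<ge> 2" and \<delta>: "0 < \<delta>" "\<delta> < 1" and d: "d > 0"
    and u: "(u + real r) * 2 powr (\<delta> * real d - (1 - \<delta>) * type_entropy r * real d) \<le>
      1 / (2 * (real r)\<^sup>2 * real d) - exp (- (\<delta>\<^sup>2 / (4 * (log 2 (real r))\<^sup>2)) * real d)"
  shows "measure_pmf.prob (random_points d r m)
      {(s, x). (convex hull (x ` {1..m} \<union> s ` {1..r}) \<inter> affine hull (s ` {1..r}))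
         face_of convex hull (x ` {1..m} \<union> s ` {1..r})}
    \<le> 8 ^ r / (\<delta>\<^sup>2 * real d) + (4 * real r * real d + 1) ^ d * exp (- (real m * u / 2 ^ d))"
    (is "measure_pmf.prob _ ?E \<le> _ + ?\<beta>")
proof -
  have "measure_pmf.prob (random_points d r m) ?E \<le>
      measure_pmf.prob (random_vertices d r) (- {s. balanced \<delta> d r s}) + ?\<beta>"
    unfolding random_points_def
  proof (rule prob_pair_pmf_le)
    fix s assume "s \<in> {s. balanced \<delta> d r s}"
    hence bal: "balanced \<delta> d r s" by simp
    let ?M = "random_vertices d m"
    let ?U = "deep_cap d r s"
    have u_le: "u \<le> real (card (?U k))" if "k \<in> normals d r s" for k
    proof -
      have "(u + real r) * 2 powr (\<delta> * real d - (1 - \<delta>) * type_entropy r * real d) \<le>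
         (real (card (?U k)) + real r) * 2 powr (\<delta> * real d - (1 - \<delta>) * type_entropy r * real d)"
        using card_deep_cap[OF bal \<delta> d r that] u by linarith
      thus ?thesis by simp
    qed
    have "measure_pmf.prob ?M {x. (s, x) \<in> ?E} = measure_pmf.prob ?M ({x. (s, x) \<in> ?E} \<inter> set_pmf ?M)"
      by (simp only: measure_Int_set_pmf)
    also have "\<dots> \<le> measure_pmf.prob ?M (\<Union>k\<in>normals d r s. {x. x ` {1..m} \<inter> ?U k = {}})"
    proof (rule measure_pmf.finite_measure_mono)
      show "{x. (s, x) \<in> ?E} \<inter> set_pmf ?M \<subseteq> (\<Union>k\<in>normals d r s. {x. x ` {1..m} \<inter> ?U k = {}})"
      proof (rule subsetI, rule ccontr)
        fix x assume x: "x \<in> {x. (s, x) \<in> ?E} \<inter> set_pmf ?M"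
          and "x \<notin> (\<Union>k\<in>normals d r s. {x. x ` {1..m} \<inter> ?U k = {}})"
        hence hits: "x ` {1..m} \<inter> ?U k \<noteq> {}" if "k \<in> normals d r s" for k using that by blast
        have X: "x ` {1..m} \<subseteq> cube_vertices d" using x random_vertices_in_cube by blast
        have "\<not> (convex hull (x ` {1..m} \<union> s ` {1..r}) \<inter> affine hull (s ` {1..r}))
           face_of convex hull (x ` {1..m} \<union> s ` {1..r})"
          by (rule not_face_if_bary_point[OF bal \<delta>(2) d _ X bary_point_in_hull_if_hits[OF bal \<delta>(2) d r X hits]])
             (use r in auto)
        thus False using x by simp
      qed
    qed simp
    also have "\<dots> \<le> (\<Sum>k\<in>normals d r s. measure_pmf.prob ?M {x. x ` {1..m} \<inter> ?U k = {}})"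
      by (intro measure_UNION_le normals_finite) auto
    also have "\<dots> \<le> (\<Sum>k\<in>normals d r s. exp (- (real m * u / 2 ^ d)))"
    proof (rule sum_mono)
      fix k assume k: "k \<in> normals d r s"
      have "measure_pmf.prob ?M {x. x ` {1..m} \<inter> ?U k = {}} \<le> exp (- (real m * real (card (?U k)) / 2 ^ d))"
        by (rule prob_miss_le) (auto simp: deep_cap_def)
      also have "\<dots> \<le> exp (- (real m * u / 2 ^ d))"
        using u_le[OF k] by (simp add: divide_right_mono mult_left_mono)
      finally show "measure_pmf.prob ?M {x. x ` {1..m} \<inter> ?U k = {}} \<le> exp (- (real m * u / 2 ^ d))" .
    qed
    also have "\<dots> = real (card (normals d r s)) * exp (- (real m * u / 2 ^ d))" by simp
    also have "\<dots> \<le> real ((4 * r * d + 1) ^ d) * exp (- (real m * u / 2 ^ d))"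
      by (intro mult_right_mono of_nat_mono card_normals) simp
    also have "\<dots> = ?\<beta>" by (simp add: algebra_simps)
    finally show "measure_pmf.prob ?M {x. (s, x) \<in> ?E} \<le> ?\<beta>" .
  qed simp
  thus ?thesis using prob_not_balanced[OF \<delta>(1) d, of r] by linarith
qed

section \<open>Limits of the error terms\<close>

lemma tendsto_balanced_bound: "(\<lambda>d. 8 ^ r / (\<delta>\<^sup>2 * real d) :: real) \<longlonglongrightarrow> 0"
  using tendsto_mult_right_zero[OF lim_inverse_n, of "8 ^ r / \<delta>\<^sup>2"] by (simp add: field_simps)

lemma tendsto_powr_neg:
  assumes "a > (0::real)"
  shows "(\<lambda>d. 2 powr (- a * real d)) \<longlonglongrightarrow> 0"
  using assms by real_asymp

text \<open>The number of normal vectors is only \<open>exp (O(d * ln d))\<close>, which the doubly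
  exponential decay beats.\<close>

lemma tendsto_exp_term:
  assumes "a > (0::real)" "r > (0::real)"
  shows "(\<lambda>d. (4 * r * real d + 1) ^ d * exp (- (2 powr (a * real d) / 2))) \<longlonglongrightarrow> 0"
  using assms by real_asymp

lemma tendsto_d_exp:
  assumes "a > (0::real)"
  shows "(\<lambda>d. real d * exp (- a * real d)) \<longlonglongrightarrow> 0"
  using assms by real_asymp

lemma tendsto_d_powr:
  assumes "a > (0::real)"
  shows "(\<lambda>d. real d * 2 powr (- a * real d)) \<longlonglongrightarrow> 0"
  using assms by real_asymp

lemma eventually_powr_ge:
  assumes "a > (0::real)"
  shows "eventually (\<lambda>d. C \<le> 2 powr (a * real d)) sequentially"
proof -
  have "filterlim (\<lambda>d. 2 powr (a * real d)) at_top sequentially" using assms by real_asymp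
  thus ?thesis by (simp add: filterlim_at_top)
qed

theorem theorem1:
  fixes r :: nat and \<epsilon> :: real and n :: "nat \<Rightarrow> nat"
  assumes "r \<ge> 3"
    and "\<epsilon> > 0"
    and "\<And>d. 1 \<le> n d" and "\<And>d. n d \<le> 2 ^ d"
    and "eventually (\<lambda>d. n d \<ge> r) sequentially"
  shows "((\<forall>d. real (n d) \<le> 2 powr ((tau_tilde r - \<epsilon>) * real d)) \<longrightarrow>
      (\<lambda>d. measure_pmf.prob (random_points d r (n d - r))
        {(s, x). let S = s ` {1..r}; X = x ` {1..n d - r}; P = convex hull (X \<union> S)
                 in (convex hull S) face_of P}) \<longlonglongrightarrow> 1)
    \<and> ((\<forall>d. real (n d) \<ge> 2 powr ((tau_tilde r + \<epsilon>) * real d)) \<longrightarrow>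
      (\<lambda>d. measure_pmf.prob (random_points d r (n d - r))
        {(s, x). let S = s ` {1..r}; X = x ` {1..n d - r}; P = convex hull (X \<union> S)
                 in (P \<inter> affine hull S) face_of P}) \<longlonglongrightarrow> 0)"
    (is "(?small \<longrightarrow> ?face \<longlonglongrightarrow> 1) \<and> (?large \<longrightarrow> ?aff_face \<longlonglongrightarrow> 0)")
proof (intro conjI impI)
  define \<kappa> where "\<kappa> = type_entropy r"
  define L where "L = log 2 (real r)"
  have r: "r \<ge> 2" and \<epsilon>: "\<epsilon> > 0" using assms by auto
  have \<tau>: "tau_tilde r = 1 - \<kappa>" using tau_tilde_eq[OF r] by (simp add: \<kappa>_def)
  have \<kappa>: "0 < \<kappa>" "\<kappa> \<le> 1" using type_entropy_pos[OF r] type_entropy_le_1 by (auto simp: \<kappa>_def)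
  have L: "L > 0" using r by (simp add: L_def)

  show "?face \<longlonglongrightarrow> 1" if small: ?small
  proof -
    \<comment> \<open>Chosen so that the loss \<open>\<delta> * (\<kappa> + 2 * L)\<close> in the
      exponent uses up at most half of \<open>\<epsilon>\<close>.\<close>
    define \<delta> where "\<delta> = min (1 / 2) (\<epsilon> / (2 * (\<kappa> + 2 * L)))"
    have "0 < \<epsilon> / (2 * (\<kappa> + 2 * L))" using \<epsilon> \<kappa> L by simp
    hence \<delta>: "0 < \<delta>" "\<delta> \<le> 1 / 2" unfolding \<delta>_def by linarith+
    have "\<delta> \<le> \<epsilon> / (2 * (\<kappa> + 2 * L))" by (simp add: \<delta>_def)
    hence \<delta>\<epsilon>: "\<delta> * (\<kappa> + 2 * L) \<le> \<epsilon> / 2" using \<kappa> L by (simp add: field_simps)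
    define bound where "bound = (\<lambda>d. 8 ^ r / (\<delta>\<^sup>2 * real d) + 2 powr (- (\<epsilon> / 2) * real d))"
    have ge: "1 - bound d \<le> ?face d" if d: "d > 0" for d
    proof -
      let ?M = "random_points d r (n d - r)"
      let ?N = "{(s, x). \<not> convex hull (s ` {1..r}) face_of convex hull (x ` {1..n d - r} \<union> s ` {1..r})}"
      have "?face d = measure_pmf.prob ?M (UNIV - ?N)"
        by (rule arg_cong[where f = "measure_pmf.prob ?M"]) (auto simp: Let_def)
      also have "\<dots> = 1 - measure_pmf.prob ?M ?N"
        using measure_pmf.prob_compl[of ?N ?M] by simp
      finally have face: "?face d = 1 - measure_pmf.prob ?M ?N" .
      have "real (n d - r) * 2 powr (real d * ((1 + \<delta>) * \<kappa> + 2 * \<delta> * L)) / 2 ^ d \<le>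
          2 powr ((1 - \<kappa> - \<epsilon>) * real d) * 2 powr (real d * ((1 + \<delta>) * \<kappa> + 2 * \<delta> * L)) / 2 ^ d"
        using small[rule_format, of d] by (intro divide_right_mono mult_right_mono) (auto simp: \<tau>)
      also have "\<dots> = 2 powr ((1 - \<kappa> - \<epsilon>) * real d + real d * ((1 + \<delta>) * \<kappa> + 2 * \<delta> * L) - real d)"
        by (simp add: powr_add powr_diff powr_realpow)
      also have "\<dots> = 2 powr ((\<delta> * (\<kappa> + 2 * L) - \<epsilon>) * real d)"
        by (rule arg_cong[where f = "(powr) 2"]) (simp add: algebra_simps)
      also have "\<dots> \<le> 2 powr (- (\<epsilon> / 2) * real d)"
        using \<delta>\<epsilon> by (intro powr_mono mult_right_mono) auto
      finally show ?thesis
        using prob_not_face_le[OF r \<delta> d, of "n d - r"] face by (simp add: bound_def \<kappa>_def L_def)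
    qed
    have "bound \<longlonglongrightarrow> 0 + 0"
      unfolding bound_def using \<epsilon> by (intro tendsto_add tendsto_balanced_bound tendsto_powr_neg) auto
    hence lim: "(\<lambda>d. 1 - bound d) \<longlonglongrightarrow> 1" using tendsto_diff[OF tendsto_const[of 1]] by fastforce
    show ?thesis
    proof (rule tendsto_sandwich[OF _ _ lim tendsto_const])
      show "eventually (\<lambda>d. 1 - bound d \<le> ?face d) sequentially"
        using eventually_gt_at_top[of 0] by eventually_elim (rule ge)
    qed (intro always_eventually allI measure_pmf.prob_le_1)
  qed

  show "?aff_face \<longlonglongrightarrow> 0" if large: ?large
  proof -
    \<comment> \<open>The bound \<open>\<kappa> / 4\<close> keeps \<open>\<rho>\<close> positive,
      and \<open>\<epsilon> / 6\<close> leaves \<open>\<epsilon> - \<kappa> + \<rho> - \<delta>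
      \<ge> \<epsilon> - 3 * \<delta> \<ge> \<epsilon> / 2\<close>.\<close>
    define \<delta> where "\<delta> = min (\<kappa> / 4) (\<epsilon> / 6)"
    have \<delta>: "0 < \<delta>" "\<delta> < 1" "\<delta> \<le> \<kappa> / 4" "\<delta> \<le> \<epsilon> / 6" using \<epsilon> \<kappa> by (auto simp: \<delta>_def)
    define \<rho> where "\<rho> = (1 - \<delta>) * \<kappa> - \<delta>"
    have "\<delta> * \<kappa> \<le> \<delta> * 1" using \<delta> \<kappa> by (intro mult_left_mono) auto
    moreover have "\<rho> = \<kappa> - \<delta> * \<kappa> - \<delta>" by (simp add: \<rho>_def left_diff_distrib)
    ultimately have \<rho>: "\<rho> \<ge> \<kappa> - 2 * \<delta>" "\<rho> > 0" using \<delta> \<kappa> by linarith+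
    define \<gamma> where "\<gamma> = \<delta>\<^sup>2 / (4 * L\<^sup>2)"
    have \<gamma>: "\<gamma> > 0" using \<delta> L by (simp add: \<gamma>_def)
    \<comment> \<open>Deep caps have at least about \<open>2 powr (\<rho> * d)\<close> points up to
      a factor polynomial in \<open>d\<close>; giving up \<open>\<delta>\<close> in the exponent
      absorbs that factor.\<close>
    define u where "u = (\<lambda>d. 2 powr ((\<rho> - \<delta>) * real d))"
    define bound where "bound = (\<lambda>d. 8 ^ r / (\<delta>\<^sup>2 * real d) +
        (4 * real r * real d + 1) ^ d * exp (- (2 powr (\<epsilon> / 2 * real d) / 2)))"

    \<comment> \<open>These are the terms of the condition on \<open>u\<close> in
      \<open>prob_face_le\<close>, multiplied by \<open>d\<close>.\<close>
    have "(\<lambda>d. real d * 2 powr (- \<delta> * real d) + real r * (real d * 2 powr (- \<rho> * real d)) +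
        real d * exp (- \<gamma> * real d)) \<longlonglongrightarrow> 0 + real r * 0 + 0"
      using \<delta> \<rho> \<gamma> by (intro tendsto_add tendsto_mult tendsto_const tendsto_d_powr tendsto_d_exp)
    moreover have "0 + real r * 0 + 0 < 1 / (2 * (real r)\<^sup>2)" using r by simp
    ultimately have "eventually (\<lambda>d. real d * 2 powr (- \<delta> * real d) +
        real r * (real d * 2 powr (- \<rho> * real d)) + real d * exp (- \<gamma> * real d) < 1 / (2 * (real r)\<^sup>2)) sequentially"
      by (rule order_tendstoD(2))
    \<comment> \<open>Once \<open>n d \<ge> 2 * r\<close>, at least half of the points remain after
      removing the \<open>r\<close> points of \<open>s\<close>. The exponent is positive because
      \<open>\<kappa> \<le> 1\<close>.\<close>
    moreover have "eventually (\<lambda>d. 2 * real r \<le> 2 powr ((1 - \<kappa> + \<epsilon>) * real d)) sequentially"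
      using \<kappa> \<epsilon> by (intro eventually_powr_ge) auto
    ultimately have le: "eventually (\<lambda>d. ?aff_face d \<le> bound d) sequentially"
      using eventually_gt_at_top[of 0]
    proof eventually_elim
      case (elim d)
      note d = elim(3)
      have "(u d + real r) * 2 powr (- \<rho> * real d) = 2 powr (- \<delta> * real d) + real r * 2 powr (- \<rho> * real d)"
        by (simp add: u_def algebra_simps flip: powr_add)
      also have "\<dots> + exp (- \<gamma> * real d) \<le> 1 / (2 * (real r)\<^sup>2) / real d"
      proof -
        have "(2 powr (- \<delta> * real d) + real r * 2 powr (- \<rho> * real d) + exp (- \<gamma> * real d)) * real d
            \<le> 1 / (2 * (real r)\<^sup>2)"
          using less_imp_le[OF elim(1)] by (simp only: distrib_left mult_ac)
        thus ?thesis using d by (simp only: pos_le_divide_eq of_nat_0_less_iff)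
      qed
      finally have u: "(u d + real r) * 2 powr (\<delta> * real d - (1 - \<delta>) * type_entropy r * real d) \<le>
          1 / (2 * (real r)\<^sup>2 * real d) - exp (- (\<delta>\<^sup>2 / (4 * (log 2 (real r))\<^sup>2)) * real d)"
        by (simp add: \<rho>_def \<gamma>_def \<kappa>_def L_def algebra_simps)
      have nd: "2 powr ((1 - \<kappa> + \<epsilon>) * real d) \<le> real (n d)" using large by (simp add: \<tau>)
      hence "real (n d) / 2 \<le> real (n d - r)" using elim(2) by linarith
      hence m: "2 powr ((1 - \<kappa> + \<epsilon>) * real d) / 2 \<le> real (n d - r)" using nd by linarith
      have "2 powr (\<epsilon> / 2 * real d) / 2 \<le> 2 powr ((\<epsilon> - \<kappa> + \<rho> - \<delta>) * real d) / 2"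
        using \<delta> \<rho> by (intro divide_right_mono powr_mono mult_right_mono) auto
      also have "(\<epsilon> - \<kappa> + \<rho> - \<delta>) * real d = (1 - \<kappa> + \<epsilon>) * real d + (\<rho> - \<delta>) * real d - real d"
        by (simp add: algebra_simps)
      also have "2 powr \<dots> / 2 = 2 powr ((1 - \<kappa> + \<epsilon>) * real d) / 2 * u d / 2 ^ d"
        by (simp add: u_def powr_add powr_diff powr_realpow)
      also have "\<dots> \<le> real (n d - r) * u d / 2 ^ d"
        using m by (intro divide_right_mono mult_right_mono) (auto simp: u_def)
      finally have "(4 * real r * real d + 1) ^ d * exp (- (real (n d - r) * u d / 2 ^ d)) \<le>
         (4 * real r * real d + 1) ^ d * exp (- (2 powr (\<epsilon> / 2 * real d) / 2))"
        by (intro mult_left_mono) auto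
      thus ?case
        using prob_face_le[OF r \<delta>(1,2) d u, of "n d - r"] by (simp add: bound_def Let_def)
    qed
    have "bound \<longlonglongrightarrow> 0 + 0"
      unfolding bound_def using \<epsilon> r by (intro tendsto_add tendsto_balanced_bound tendsto_exp_term) auto
    hence lim: "bound \<longlonglongrightarrow> 0" by simp
    show ?thesis
      by (rule tendsto_sandwich[OF _ le tendsto_const lim]) simp
  qed
qed

end
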